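(* Let $(A,\cdot_A,a_A)$ be a left-symmetric algebroid. (1) If $(H,\mathfrak B)$ is a $\mathrm{KV\Omega}$-structure on $A$ and $\mathfrak B$ is nondegenerate, then $(\mathfrak B,N)$, where $N=H^\sharp\circ\mathfrak B^\natural$, is a pseudo-Hessian-Nijenhuis structure on $A$. (2) Conversely, if $(\mathfrak B,N)$ is a pseudo-Hessian-Nijenhuis structure on $A$ with $\mathfrak B$ nondegenerate, then $(\mathcal H,\mathfrak B)$, where $\mathcal H^\sharp=N\circ(\mathfrak B^\natural)^{-1}$, is a $\mathrm{KV\Omega}$-structure on $A$.
   Context: Left-symmetric algebroids. A left-symmetric algebroid $(A,\cdot_A,a_A)$ is a smooth real vector bundle $A\to M$ with an $\mathbb R$-bilinear operation $\cdot_A$ on $\Gamma(A)$ such that $x\cdot_A(y\cdot_A z)-(x\cdot_A y)\cdot_A z$ is symmetric in $x,y$, and a bundle map $a_A:A\to TM$ such that $x\cdot_A(fy)=f(x\cdot_A y)+a_A(x)(f)\,y$ and $(fx)\cdot_A y=f(x\cdot_A y)$ for $x,y\in\Gamma(A)$, $f\in C^\infty(M)$. Put $[x,y]_A=x\cdot_A y-y\cdot_A x$. Nijenhuis operators. A bundle map $N:A\to A$ (over the identity) is a Nijenhuis operator on $A$ if $N(x)\cdot_A N(y)=N\big(x\cdot_A N(y)+N(x)\cdot_A y-N(x\cdot_A y)\big)$ for all $x,y\in\Gamma(A)$. Koszul-Vinberg structures. $\mathrm{Sym}^2(A)$ is the set of symmetric sections $H$ of $A\otimes A$; $H^\sharp:A^*\to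 A$ is $\langle H^\sharp(\alpha),\beta\rangle=H(\alpha,\beta)$. For $\alpha_i\in\Gamma(A^* )$, $$\begin{aligned}[\![ H,H]\!]_A(\alpha_1,\alpha_2,\alpha_3)=\ &a_A(H^\sharp(\alpha_1))\langle H^\sharp(\alpha_2),\alpha_3\rangle-a_A(H^\sharp(\alpha_2))\langle H^\sharp(\alpha_1),\alpha_3\rangle+\langle\alpha_1,H^\sharp(\alpha_2)\cdot_A H^\sharp(\alpha_3)\rangle\\&-\langle\alpha_2,H^\sharp(\alpha_1)\cdot_A H^\sharp(\alpha_3)\rangle-\langle\alpha_3,[H^\sharp(\alpha_1),H^\sharp(\alpha_2)]_A\rangle.\end{aligned}$$ $H$ is a Koszul-Vinberg structure if $[\![ H,H]\!]_A=0$. Cocycles and pseudo-Hessian structures. $\mathrm{Sym}^2(A^* )$ is the set of symmetric sections $\mathfrak B$ of $A^*\otimes A^*$; $\mathfrak B^\natural:A\to A^*$ is $\langle\mathfrak B^\natural(x),y\rangle=\mathfrak B(x,y)$; $\mathfrak B$ is nondegenerate if $\mathfrak B^\natural$ is invertible. $\delta_A\mathfrak B(x,y,z)=a_A(x)\mathfrak B(y,z)-a_A(y)\mathfrak B(x,z)-\mathfrak B(y,x\cdot_A z)+\mathfrak B(x,y\cdot_A z)-\mathfrak B([x,y]_A,z)$; $\mathfrak B$ is a $2$-cocycle, equivalently a pseudo-Hessian structure on $A$, if $\delta_A\mathfrak B=0$. For a bundle map $N:A\to A$, $\mathfrak B_N(x,y)=\mathfrak B(N(x),y)$. $\mathrm{KV\Omega}$-structure: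 a pair $(H,\mathfrak B)$ with $H$ a Koszul-Vinberg structure and $\mathfrak B\in \mathrm{Sym}^2(A^* )$ a $2$-cocycle such that $\mathfrak B_N$ is also a $2$-cocycle, where $N=H^\sharp\circ\mathfrak B^\natural$. Pseudo-Hessian-Nijenhuis (HN) structure: a pair $(\mathfrak B,N)$ with $\mathfrak B$ a pseudo-Hessian structure and $N$ a Nijenhuis operator on $A$ such that $\mathfrak B(N(x),y)=\mathfrak B(x,N(y))$ for all $x,y\in\Gamma(A)$ and $\delta_A\mathfrak B_N=0$. *)

theory Defs
  imports "HOL-Analysis.Analysis"
begin

section \<open>Smooth functions on open subsets of a finite-dimensional space\<close>

primrec Ck_on :: "nat \<Rightarrow> 'e::real_normed_vector set \<Rightarrow> ('e \<Rightarrow> 'b::real_normed_vector) \<Rightarrow> bool" where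
  "Ck_on 0 S f \<longleftrightarrow> continuous_on S f"
| "Ck_on (Suc k) S f \<longleftrightarrow>
     (\<forall>x\<in>S. f differentiable (at x)) \<and> (\<forall>v. Ck_on k S (\<lambda>x. frechet_derivative f (at x) v))"

definition smooth_on :: "'e::real_normed_vector set \<Rightarrow> ('e \<Rightarrow> 'b::real_normed_vector) \<Rightarrow> bool" where
  "smooth_on S f \<longleftrightarrow> (\<forall>k. Ck_on k S f)"

text \<open>Model spaces are finite-dimensional inner product spaces rather than types of class
  \<^class>\<open>euclidean_space\<close>, because the latter have positive dimension, whereas
  zero-dimensional manifolds (left-symmetric algebras) and bundles of rank 0 are allowed here.\<close>

definition finite_dimensional :: "'e::real_vector itself \<Rightarrow> bool" where
  "finite_dimensional _ \<longleftrightarrow> (\<exists>b :: 'e set. finite b \<and> span b = UNIV)"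


section \<open>Smooth manifolds\<close>

text \<open>The points of the manifold form a whole type \<open>'m\<close>, whose type class topology is the
  topology of the manifold. A chart \<open>(V, \<phi>)\<close> consists of its domain and its coordinate map,
  the values of \<open>\<phi>\<close> outside \<open>V\<close> being irrelevant.
  The atlas need not be maximal.\<close>

record ('m, 'e) manifold =
  charts :: "('m set \<times> ('m \<Rightarrow> 'e)) set"

definition smooth_manifold ::
  "('m::{t2_space,second_countable_topology}, 'e::real_inner, 'z) manifold_scheme \<Rightarrow> bool" where
  "smooth_manifold M \<longleftrightarrow>
     finite_dimensional TYPE('e) \<and>
     (\<Union>(V, \<phi>)\<in>charts M. V) = UNIV \<and>
     (\<forall>(V, \<phi>)\<in>charts M.
        open V \<and> open (\<phi> ` V) \<and> homeomorphism V (\<phi> ` V) \<phi> (inv_into V \<phi>)) \<and>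
     (\<forall>(V, \<phi>)\<in>charts M. \<forall>(W, \<psi>)\<in>charts M.
        smooth_on (\<phi> ` (V \<inter> W)) (\<lambda>x. \<psi> (inv_into V \<phi> x)))"

definition msmooth_on ::
  "('m, 'e::real_normed_vector, 'z) manifold_scheme \<Rightarrow> 'm set \<Rightarrow>
    ('m \<Rightarrow> 'b::real_normed_vector) \<Rightarrow> bool" where
  "msmooth_on M U f \<longleftrightarrow>
     (\<forall>(V, \<phi>)\<in>charts M. smooth_on (\<phi> ` (U \<inter> V)) (\<lambda>x. f (inv_into V \<phi> x)))"

definition Cinf :: "('m, 'e::real_normed_vector, 'z) manifold_scheme \<Rightarrow> ('m \<Rightarrow> real) set" where
  "Cinf M = {f. msmooth_on M UNIV f}"

text \<open>Tangent vectors at \<open>p\<close> are the derivations at \<open>p\<close> of the algebra of smooth functions,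
  extended by 0 to non-smooth functions.\<close>

definition tangent_space ::
  "('m, 'e::real_normed_vector, 'z) manifold_scheme \<Rightarrow> 'm \<Rightarrow> (('m \<Rightarrow> real) \<Rightarrow> real) set" where
  "tangent_space M p = {D.
     (\<forall>f\<in>Cinf M. \<forall>g\<in>Cinf M. D (\<lambda>q. f q + g q) = D f + D g) \<and>
     (\<forall>c. \<forall>f\<in>Cinf M. D (\<lambda>q. c * f q) = c * D f) \<and>
     (\<forall>f\<in>Cinf M. \<forall>g\<in>Cinf M. D (\<lambda>q. f q * g q) = f p * D g + g p * D f) \<and>
     (\<forall>f. f \<notin> Cinf M \<longrightarrow> D f = 0)}"


section \<open>Vector bundles\<close>

definition linear_on :: "'a::real_vector set \<Rightarrow> ('a \<Rightarrow> 'b::real_vector) \<Rightarrow> bool" where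
  "linear_on V f \<longleftrightarrow>
     (\<forall>u\<in>V. \<forall>v\<in>V. f (u + v) = f u + f v) \<and> (\<forall>c. \<forall>u\<in>V. f (c *\<^sub>R u) = c *\<^sub>R f u)"

text \<open>The fibres are linear subspaces of one real vector space \<open>'v\<close>, which carries no topology and
  may be infinite-dimensional. This is no restriction on the bundle: any family of vector spaces
  embeds fibrewise in its direct sum. The topology and the smooth structure come
  from the local trivialisations \<open>(U, \<Phi>)\<close> alone, where \<open>\<Phi> p\<close> identifies the fibre over
  \<open>p \<in> U\<close> with the model fibre \<open>'f\<close>.\<close>

record ('m, 'e, 'v, 'f) vbundle = "('m, 'e) manifold" +
  fibre :: "'m \<Rightarrow> 'v set"
  trivs :: "('m set \<times> ('m \<Rightarrow> 'v \<Rightarrow> 'f)) set"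

definition triv_inv ::
  "('m, 'e, 'v, 'f, 'z) vbundle_scheme \<Rightarrow> ('m \<Rightarrow> 'v \<Rightarrow> 'f) \<Rightarrow> 'm \<Rightarrow> 'f \<Rightarrow> 'v" where
  "triv_inv A \<Phi> p = inv_into (fibre A p) (\<Phi> p)"

definition vector_bundle ::
  "('m::{t2_space,second_countable_topology}, 'e::real_inner, 'v::real_vector, 'f::real_inner, 'z)
    vbundle_scheme \<Rightarrow> bool" where
  "vector_bundle A \<longleftrightarrow>
     smooth_manifold A \<and>
     finite_dimensional TYPE('f) \<and>
     (\<forall>p. subspace (fibre A p)) \<and>
     (\<Union>(U, \<Phi>)\<in>trivs A. U) = UNIV \<and>
     (\<forall>(U, \<Phi>)\<in>trivs A. open U \<and>
        (\<forall>p\<in>U. linear_on (fibre A p) (\<Phi> p) \<and> bij_betw (\<Phi> p) (fibre A p) UNIV)) \<and>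
     (\<forall>(U, \<Phi>)\<in>trivs A. \<forall>(W, \<Psi>)\<in>trivs A. \<forall>e.
        msmooth_on A (U \<inter> W) (\<lambda>p. \<Psi> p (triv_inv A \<Phi> p e)))"

definition sections ::
  "('m, 'e::real_normed_vector, 'v, 'f::real_normed_vector, 'z) vbundle_scheme \<Rightarrow> ('m \<Rightarrow> 'v) set" where
  "sections A = {x. (\<forall>p. x p \<in> fibre A p) \<and>
     (\<forall>(U, \<Phi>)\<in>trivs A. msmooth_on A U (\<lambda>p. \<Phi> p (x p)))}"

text \<open>Functionals on a fibre are extended by 0 outside the fibre, so that equality of functions is
  equality of functionals.\<close>

definition dual_fibre ::
  "('m, 'e, 'v::real_vector, 'f, 'z) vbundle_scheme \<Rightarrow> 'm \<Rightarrow> ('v \<Rightarrow> real) set" where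
  "dual_fibre A p = {\<alpha>. linear_on (fibre A p) \<alpha> \<and> (\<forall>u. u \<notin> fibre A p \<longrightarrow> \<alpha> u = 0)}"

definition dual_sections ::
  "('m, 'e::real_normed_vector, 'v::real_vector, 'f, 'z) vbundle_scheme \<Rightarrow> ('m \<Rightarrow> 'v \<Rightarrow> real) set" where
  "dual_sections A = {\<alpha>. (\<forall>p. \<alpha> p \<in> dual_fibre A p) \<and>
     (\<forall>(U, \<Phi>)\<in>trivs A. \<forall>e. msmooth_on A U (\<lambda>p. \<alpha> p (triv_inv A \<Phi> p e)))}"

definition pair :: "('m \<Rightarrow> 'v \<Rightarrow> real) \<Rightarrow> ('m \<Rightarrow> 'v) \<Rightarrow> 'm \<Rightarrow> real" where
  "pair \<alpha> x = (\<lambda>p. \<alpha> p (x p))"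

definition bundle_endo ::
  "('m, 'e::real_normed_vector, 'v::real_vector, 'f::real_normed_vector, 'z) vbundle_scheme \<Rightarrow>
    ('m \<Rightarrow> 'v \<Rightarrow> 'v) \<Rightarrow> bool" where
  "bundle_endo A N \<longleftrightarrow>
     (\<forall>p. N p ` fibre A p \<subseteq> fibre A p \<and> linear_on (fibre A p) (N p)) \<and>
     (\<forall>(U, \<Phi>)\<in>trivs A. \<forall>e. msmooth_on A U (\<lambda>p. \<Phi> p (N p (triv_inv A \<Phi> p e))))"

definition app :: "('m \<Rightarrow> 'v \<Rightarrow> 'w) \<Rightarrow> ('m \<Rightarrow> 'v) \<Rightarrow> 'm \<Rightarrow> 'w" where
  "app N x = (\<lambda>p. N p (x p))"

text \<open>A smooth bundle map \<open>A \<rightarrow> TM\<close> over the identity. Smoothness is expressed in the local frames: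
  on the overlap of a trivialisation and a chart, the image of a constant local section \<open>e\<close> is a
  vector field whose component function \<open>w\<close> with respect to the chart is smooth.\<close>

definition bundle_map_to_tangent ::
  "('m, 'e::real_normed_vector, 'v::real_vector, 'f, 'z) vbundle_scheme \<Rightarrow>
    ('m \<Rightarrow> 'v \<Rightarrow> ('m \<Rightarrow> real) \<Rightarrow> real) \<Rightarrow> bool" where
  "bundle_map_to_tangent A a \<longleftrightarrow>
     (\<forall>p. \<forall>u\<in>fibre A p. a p u \<in> tangent_space A p) \<and>
     (\<forall>p f. linear_on (fibre A p) (\<lambda>u. a p u f)) \<and>
     (\<forall>(U, \<Phi>)\<in>trivs A. \<forall>(V, \<phi>)\<in>charts A. \<forall>e. \<exists>w :: 'm \<Rightarrow> 'e.
        msmooth_on A (U \<inter> V) w \<and>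
        (\<forall>p\<in>U \<inter> V. \<forall>f\<in>Cinf A. a p (triv_inv A \<Phi> p e) f =
           frechet_derivative (\<lambda>x. f (inv_into V \<phi> x)) (at (\<phi> p)) (w p)))"


section \<open>Left-symmetric algebroids\<close>

record ('m, 'e, 'v, 'f) ls_algebroid = "('m, 'e, 'v, 'f) vbundle" +
  prd :: "('m \<Rightarrow> 'v) \<Rightarrow> ('m \<Rightarrow> 'v) \<Rightarrow> 'm \<Rightarrow> 'v"
  anchor :: "'m \<Rightarrow> 'v \<Rightarrow> ('m \<Rightarrow> real) \<Rightarrow> real"

definition lie ::
  "('m, 'e, 'v, 'f, 'z) ls_algebroid_scheme \<Rightarrow> ('m \<Rightarrow> 'v) \<Rightarrow> ('m \<Rightarrow> real) \<Rightarrow> 'm \<Rightarrow> real" where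
  "lie A x f = (\<lambda>p. anchor A p (x p) f)"

definition associator ::
  "('m, 'e, 'v::real_vector, 'f, 'z) ls_algebroid_scheme \<Rightarrow>
    ('m \<Rightarrow> 'v) \<Rightarrow> ('m \<Rightarrow> 'v) \<Rightarrow> ('m \<Rightarrow> 'v) \<Rightarrow> 'm \<Rightarrow> 'v" where
  "associator A x y z = (\<lambda>p. prd A x (prd A y z) p - prd A (prd A x y) z p)"

definition left_symmetric_algebroid ::
  "('m::{t2_space,second_countable_topology}, 'e::real_inner, 'v::real_vector, 'f::real_inner, 'z)
    ls_algebroid_scheme \<Rightarrow> bool" where
  "left_symmetric_algebroid A \<longleftrightarrow>
     vector_bundle A \<and>
     (\<forall>x\<in>sections A. \<forall>y\<in>sections A. prd A x y \<in> sections A) \<and>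
     (\<forall>x\<in>sections A. \<forall>y\<in>sections A. \<forall>z\<in>sections A.
        prd A (\<lambda>p. x p + y p) z = (\<lambda>p. prd A x z p + prd A y z p) \<and>
        prd A z (\<lambda>p. x p + y p) = (\<lambda>p. prd A z x p + prd A z y p)) \<and>
     (\<forall>c. \<forall>x\<in>sections A. \<forall>y\<in>sections A.
        prd A (\<lambda>p. c *\<^sub>R x p) y = (\<lambda>p. c *\<^sub>R prd A x y p) \<and>
        prd A x (\<lambda>p. c *\<^sub>R y p) = (\<lambda>p. c *\<^sub>R prd A x y p)) \<and>
     (\<forall>x\<in>sections A. \<forall>y\<in>sections A. \<forall>z\<in>sections A. associator A x y z = associator A y x z) \<and>
     bundle_map_to_tangent A (anchor A) \<and>
     (\<forall>f\<in>Cinf A. \<forall>x\<in>sections A. \<forall>y\<in>sections A.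
        prd A x (\<lambda>p. f p *\<^sub>R y p) = (\<lambda>p. f p *\<^sub>R prd A x y p + lie A x f p *\<^sub>R y p) \<and>
        prd A (\<lambda>p. f p *\<^sub>R x p) y = (\<lambda>p. f p *\<^sub>R prd A x y p))"

definition bracket ::
  "('m, 'e, 'v::real_vector, 'f, 'z) ls_algebroid_scheme \<Rightarrow>
    ('m \<Rightarrow> 'v) \<Rightarrow> ('m \<Rightarrow> 'v) \<Rightarrow> 'm \<Rightarrow> 'v" where
  "bracket A x y = (\<lambda>p. prd A x y p - prd A y x p)"

definition nijenhuis ::
  "('m, 'e::real_normed_vector, 'v::real_vector, 'f::real_normed_vector, 'z) ls_algebroid_scheme \<Rightarrow>
    ('m \<Rightarrow> 'v \<Rightarrow> 'v) \<Rightarrow> bool" where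
  "nijenhuis A N \<longleftrightarrow>
     bundle_endo A N \<and>
     (\<forall>x\<in>sections A. \<forall>y\<in>sections A.
        prd A (app N x) (app N y) =
          app N (\<lambda>p. prd A x (app N y) p + prd A (app N x) y p - app N (prd A x y) p))"


section \<open>Koszul-Vinberg structures\<close>

text \<open>A symmetric section of \<open>A \<otimes> A\<close> is given by its values \<open>H p \<alpha> \<beta>\<close> on pairs of covectors, i.e.
  as a smooth family of symmetric bilinear forms on the dual fibres; \<open>pull A \<Phi> p \<epsilon>\<close> is the
  covector at \<open>p\<close> with constant coordinates \<open>\<epsilon>\<close> in the dual trivialisation.\<close>

definition pull ::
  "('m, 'e, 'v, 'f, 'z) vbundle_scheme \<Rightarrow> ('m \<Rightarrow> 'v \<Rightarrow> 'f) \<Rightarrow> 'm \<Rightarrow> ('f \<Rightarrow> real) \<Rightarrow> 'v \<Rightarrow> real" where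
  "pull A \<Phi> p \<epsilon> = (\<lambda>u. if u \<in> fibre A p then \<epsilon> (\<Phi> p u) else 0)"

definition Sym2 ::
  "('m, 'e::real_normed_vector, 'v::real_vector, 'f::real_vector, 'z) vbundle_scheme \<Rightarrow>
    ('m \<Rightarrow> ('v \<Rightarrow> real) \<Rightarrow> ('v \<Rightarrow> real) \<Rightarrow> real) set" where
  "Sym2 A = {H.
     (\<forall>p. \<forall>\<alpha>\<in>dual_fibre A p. \<forall>\<beta>\<in>dual_fibre A p.
        H p \<alpha> \<beta> = H p \<beta> \<alpha> \<and>
        (\<forall>\<gamma>\<in>dual_fibre A p. H p (\<lambda>u. \<alpha> u + \<beta> u) \<gamma> = H p \<alpha> \<gamma> + H p \<beta> \<gamma>) \<and>
        (\<forall>c. H p (\<lambda>u. c * \<alpha> u) \<beta> = c * H p \<alpha> \<beta>)) \<and>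
     (\<forall>(U, \<Phi>)\<in>trivs A. \<forall>\<epsilon> \<eta>. linear \<epsilon> \<longrightarrow> linear \<eta> \<longrightarrow>
        msmooth_on A U (\<lambda>p. H p (pull A \<Phi> p \<epsilon>) (pull A \<Phi> p \<eta>)))}"

definition sharp ::
  "('m, 'e, 'v::real_vector, 'f, 'z) vbundle_scheme \<Rightarrow>
    ('m \<Rightarrow> ('v \<Rightarrow> real) \<Rightarrow> ('v \<Rightarrow> real) \<Rightarrow> real) \<Rightarrow> 'm \<Rightarrow> ('v \<Rightarrow> real) \<Rightarrow> 'v" where
  "sharp A H p \<alpha> = (THE u. u \<in> fibre A p \<and> (\<forall>\<beta>\<in>dual_fibre A p. \<beta> u = H p \<alpha> \<beta>))"

text \<open>The 2-tensor \<open>H\<close> with \<open>sharp A H = S\<close> for a given map \<open>S\<close> from the dual bundle to the bundle.\<close>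

definition tensor_of_sharp ::
  "('m \<Rightarrow> ('v \<Rightarrow> real) \<Rightarrow> 'v) \<Rightarrow> 'm \<Rightarrow> ('v \<Rightarrow> real) \<Rightarrow> ('v \<Rightarrow> real) \<Rightarrow> real" where
  "tensor_of_sharp S p \<alpha> \<beta> = \<beta> (S p \<alpha>)"

definition kv_bracket ::
  "('m, 'e, 'v::real_vector, 'f, 'z) ls_algebroid_scheme \<Rightarrow>
    ('m \<Rightarrow> ('v \<Rightarrow> real) \<Rightarrow> ('v \<Rightarrow> real) \<Rightarrow> real) \<Rightarrow>
    ('m \<Rightarrow> 'v \<Rightarrow> real) \<Rightarrow> ('m \<Rightarrow> 'v \<Rightarrow> real) \<Rightarrow> ('m \<Rightarrow> 'v \<Rightarrow> real) \<Rightarrow> 'm \<Rightarrow> real" where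
  "kv_bracket A H \<alpha>1 \<alpha>2 \<alpha>3 = (\<lambda>p.
     (let h1 = app (sharp A H) \<alpha>1; h2 = app (sharp A H) \<alpha>2; h3 = app (sharp A H) \<alpha>3 in
        lie A h1 (pair \<alpha>3 h2) p
      - lie A h2 (pair \<alpha>3 h1) p
      + pair \<alpha>1 (prd A h2 h3) p
      - pair \<alpha>2 (prd A h1 h3) p
      - pair \<alpha>3 (bracket A h1 h2) p))"

definition koszul_vinberg ::
  "('m, 'e::real_normed_vector, 'v::real_vector, 'f::real_normed_vector, 'z) ls_algebroid_scheme \<Rightarrow>
    ('m \<Rightarrow> ('v \<Rightarrow> real) \<Rightarrow> ('v \<Rightarrow> real) \<Rightarrow> real) \<Rightarrow> bool" where
  "koszul_vinberg A H \<longleftrightarrow>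
     H \<in> Sym2 A \<and>
     (\<forall>\<alpha>1\<in>dual_sections A. \<forall>\<alpha>2\<in>dual_sections A. \<forall>\<alpha>3\<in>dual_sections A.
        kv_bracket A H \<alpha>1 \<alpha>2 \<alpha>3 = (\<lambda>p. 0))"


section \<open>Pseudo-Hessian structures\<close>

definition Sym2_dual ::
  "('m, 'e::real_normed_vector, 'v::real_vector, 'f, 'z) vbundle_scheme \<Rightarrow>
    ('m \<Rightarrow> 'v \<Rightarrow> 'v \<Rightarrow> real) set" where
  "Sym2_dual A = {B.
     (\<forall>p. \<forall>u\<in>fibre A p. linear_on (fibre A p) (\<lambda>v. B p v u) \<and>
        (\<forall>v\<in>fibre A p. B p u v = B p v u)) \<and>
     (\<forall>(U, \<Phi>)\<in>trivs A. \<forall>e e'.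
        msmooth_on A U (\<lambda>p. B p (triv_inv A \<Phi> p e) (triv_inv A \<Phi> p e')))}"

definition flat ::
  "('m, 'e, 'v, 'f, 'z) vbundle_scheme \<Rightarrow> ('m \<Rightarrow> 'v \<Rightarrow> 'v \<Rightarrow> real) \<Rightarrow> 'm \<Rightarrow> 'v \<Rightarrow> 'v \<Rightarrow> real" where
  "flat A B p u = (\<lambda>v. if v \<in> fibre A p then B p u v else 0)"

definition nondegenerate ::
  "('m, 'e, 'v::real_vector, 'f, 'z) vbundle_scheme \<Rightarrow> ('m \<Rightarrow> 'v \<Rightarrow> 'v \<Rightarrow> real) \<Rightarrow> bool" where
  "nondegenerate A B \<longleftrightarrow> (\<forall>p. bij_betw (flat A B p) (fibre A p) (dual_fibre A p))"

definition flat_inv ::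
  "('m, 'e, 'v, 'f, 'z) vbundle_scheme \<Rightarrow> ('m \<Rightarrow> 'v \<Rightarrow> 'v \<Rightarrow> real) \<Rightarrow> 'm \<Rightarrow> ('v \<Rightarrow> real) \<Rightarrow> 'v" where
  "flat_inv A B p = inv_into (fibre A p) (flat A B p)"

definition eval2 ::
  "('m \<Rightarrow> 'v \<Rightarrow> 'v \<Rightarrow> real) \<Rightarrow> ('m \<Rightarrow> 'v) \<Rightarrow> ('m \<Rightarrow> 'v) \<Rightarrow> 'm \<Rightarrow> real" where
  "eval2 B x y = (\<lambda>p. B p (x p) (y p))"

definition coboundary ::
  "('m, 'e, 'v::real_vector, 'f, 'z) ls_algebroid_scheme \<Rightarrow> ('m \<Rightarrow> 'v \<Rightarrow> 'v \<Rightarrow> real) \<Rightarrow>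
    ('m \<Rightarrow> 'v) \<Rightarrow> ('m \<Rightarrow> 'v) \<Rightarrow> ('m \<Rightarrow> 'v) \<Rightarrow> 'm \<Rightarrow> real" where
  "coboundary A B x y z = (\<lambda>p.
       lie A x (eval2 B y z) p
     - lie A y (eval2 B x z) p
     - eval2 B y (prd A x z) p
     + eval2 B x (prd A y z) p
     - eval2 B (bracket A x y) z p)"

definition delta_closed ::
  "('m, 'e::real_normed_vector, 'v::real_vector, 'f::real_normed_vector, 'z) ls_algebroid_scheme \<Rightarrow>
    ('m \<Rightarrow> 'v \<Rightarrow> 'v \<Rightarrow> real) \<Rightarrow> bool" where
  "delta_closed A B \<longleftrightarrow>
     (\<forall>x\<in>sections A. \<forall>y\<in>sections A. \<forall>z\<in>sections A. coboundary A B x y z = (\<lambda>p. 0))"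

text \<open>A 2-cocycle is the same thing as a pseudo-Hessian structure; nondegeneracy is not part of the
  definition.\<close>

definition pseudo_hessian ::
  "('m, 'e::real_normed_vector, 'v::real_vector, 'f::real_normed_vector, 'z) ls_algebroid_scheme \<Rightarrow>
    ('m \<Rightarrow> 'v \<Rightarrow> 'v \<Rightarrow> real) \<Rightarrow> bool" where
  "pseudo_hessian A B \<longleftrightarrow> B \<in> Sym2_dual A \<and> delta_closed A B"

definition twist ::
  "('m \<Rightarrow> 'v \<Rightarrow> 'v \<Rightarrow> real) \<Rightarrow> ('m \<Rightarrow> 'v \<Rightarrow> 'v) \<Rightarrow> 'm \<Rightarrow> 'v \<Rightarrow> 'v \<Rightarrow> real" where
  "twist B N p u v = B p (N p u) v"

definition sharp_flat ::
  "('m, 'e, 'v::real_vector, 'f, 'z) vbundle_scheme \<Rightarrow>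
    ('m \<Rightarrow> ('v \<Rightarrow> real) \<Rightarrow> ('v \<Rightarrow> real) \<Rightarrow> real) \<Rightarrow> ('m \<Rightarrow> 'v \<Rightarrow> 'v \<Rightarrow> real) \<Rightarrow> 'm \<Rightarrow> 'v \<Rightarrow> 'v" where
  "sharp_flat A H B p u = sharp A H p (flat A B p u)"

definition KVOmega ::
  "('m, 'e::real_normed_vector, 'v::real_vector, 'f::real_normed_vector, 'z) ls_algebroid_scheme \<Rightarrow>
    ('m \<Rightarrow> ('v \<Rightarrow> real) \<Rightarrow> ('v \<Rightarrow> real) \<Rightarrow> real) \<Rightarrow> ('m \<Rightarrow> 'v \<Rightarrow> 'v \<Rightarrow> real) \<Rightarrow> bool" where
  "KVOmega A H B \<longleftrightarrow>
     koszul_vinberg A H \<and> pseudo_hessian A B \<and> pseudo_hessian A (twist B (sharp_flat A H B))"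

definition pseudo_hessian_nijenhuis ::
  "('m, 'e::real_normed_vector, 'v::real_vector, 'f::real_normed_vector, 'z) ls_algebroid_scheme \<Rightarrow>
    ('m \<Rightarrow> 'v \<Rightarrow> 'v \<Rightarrow> real) \<Rightarrow> ('m \<Rightarrow> 'v \<Rightarrow> 'v) \<Rightarrow> bool" where
  "pseudo_hessian_nijenhuis A B N \<longleftrightarrow>
     pseudo_hessian A B \<and> nijenhuis A N \<and>
     (\<forall>x\<in>sections A. \<forall>y\<in>sections A. eval2 B (app N x) y = eval2 B x (app N y)) \<and>
     delta_closed A (twist B N)"

end

(* Let E(x,z) = x.N(z) - N(x.z), so that the Nijenhuis torsion is T(x,z) = E(Nx,z) - N E(x,z). If B and B_N
   are cocycles, then B(y,E(x,z)) is symmetric in x and y, and the Koszul-Vinberg bracket of H on the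
   covectors B(x1), B(x2), B(x3) equals -B(x2,T(x1,x3)). Since B is nondegenerate, the bracket
   vanishes iff T does. To pass from sections to fibres one needs a global section through
   every vector (bump functions), and to pass from covector fields to sections the smoothness
   of the inverse of B (Gaussian elimination in a local frame). *)

theory Submission
  imports Defs
begin

section \<open>Calculus of smooth maps\<close>

text \<open>The anchor derivatives stand between the bracket and the torsion, and each cocycle
  identity serves to remove them. Since B_N(s,t) = B(s,Nt), the coboundaries of B at (x,y,Nz) and of
  B_N at (x,y,z) have the same derivative terms and the same [x,y] term, so their difference
  contains products only. In the bracket, the identity for B at (Nx1,Nx2,x3) leaves B(x1,E(Nx2,x3))
  - B(x2,E(Nx1,x3)). The symmetry of the defect exchanges Nx2 and x1 in the first summand, and N is
  symmetric for B; so everything ends up paired with x2. Most of the length is smoothness. The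
  fibres carry no topology, so each such claim is read off from coordinates in a trivialisation.
  Model spaces may have dimension zero, so orthonormal frames and compact balls are built
  directly.\<close>

lemma Ck_on_subset:
  assumes "Ck_on k S f" "T \<subseteq> S"
  shows "Ck_on k T f"
  using assms by (induction k arbitrary: f) (auto intro: continuous_on_subset)

text \<open>Openness turns agreement on \<open>S\<close> into agreement near each point, so the
  derivatives agree as well. Coordinate expressions on a manifold are meaningful only on chart
  images and have to be compared in this form.\<close>

lemma Ck_on_cong:
  assumes "open S" "Ck_on k S f" "\<And>x. x \<in> S \<Longrightarrow> f x = g x"
  shows "Ck_on k S g"
  using assms(2,3)
proof (induction k arbitrary: f g)
  case 0
  then show ?case by (simp cong: continuous_on_cong)
next
  case (Suc k)
  have D: "(g has_derivative frechet_derivative f (at x)) (at x)" if "x \<in> S" for x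
  proof (rule has_derivative_transform_within_open[OF _ assms(1) that])
    show "(f has_derivative frechet_derivative f (at x)) (at x)"
      using Suc.prems(1) that frechet_derivative_works by auto
  qed (use Suc.prems(2) in simp)
  have "Ck_on k S (\<lambda>x. frechet_derivative g (at x) v)" for v
  proof (rule Suc.IH)
    show "Ck_on k S (\<lambda>x. frechet_derivative f (at x) v)"
      using Suc.prems(1) by simp
    show "frechet_derivative f (at x) v = frechet_derivative g (at x) v" if "x \<in> S" for x
      using frechet_derivative_at[OF D[OF that]] by simp
  qed
  moreover have "g differentiable at x" if "x \<in> S" for x
    using D[OF that] differentiable_def by blast
  ultimately show ?case
    by simp
qed

text \<open>Derivatives are unique, so any explicit derivative may stand in for the choice made by
  \<open>frechet_derivative\<close>. The closure rules differentiate symbolically through this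
  rule.\<close>

lemma Ck_on_SucI:
  assumes "open S" "\<And>x. x \<in> S \<Longrightarrow> (f has_derivative f' x) (at x)"
    and "\<And>v. Ck_on k S (\<lambda>x. f' x v)"
  shows "Ck_on (Suc k) S f"
proof -
  have "Ck_on k S (\<lambda>x. frechet_derivative f (at x) v)" for v
    by (rule Ck_on_cong[OF assms(1) assms(3)[of v]])
      (simp add: frechet_derivative_at[OF assms(2), symmetric])
  then show ?thesis
    using assms(2) by (auto simp: differentiable_def)
qed

lemma Ck_on_SucD: "Ck_on (Suc k) S f \<Longrightarrow> Ck_on k S f"
proof (induction k arbitrary: f)
  case 0
  then show ?case
    by (simp add: continuous_at_imp_continuous_on differentiable_imp_continuous_within)
next
  case (Suc k)
  from Suc.prems have "f differentiable at x" if "x \<in> S" for x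
    using that by simp
  moreover from Suc.prems have "Ck_on k S (\<lambda>x. frechet_derivative f (at x) v)" for v
    by (intro Suc.IH) simp
  ultimately show ?case
    by simp
qed

lemma Ck_on_has_derivative:
  "Ck_on (Suc k) S f \<Longrightarrow> x \<in> S \<Longrightarrow> (f has_derivative frechet_derivative f (at x)) (at x)"
  using frechet_derivative_works[of f "at x"] by simp

lemma Ck_on_const: "open S \<Longrightarrow> Ck_on k S (\<lambda>x. c)"
proof (induction k arbitrary: c)
  case (Suc k)
  then show ?case
    by (intro Ck_on_SucI[where f' = "\<lambda>x v. 0"]) auto
qed auto

lemma Ck_on_add:
  assumes "open S" "Ck_on k S f" "Ck_on k S g"
  shows "Ck_on k S (\<lambda>x. f x + g x)"
  using assms(2,3)
proof (induction k arbitrary: f g)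
  case 0
  then show ?case by (auto intro: continuous_intros)
next
  case (Suc k)
  show ?case
    by (rule Ck_on_SucI[OF assms(1) has_derivative_add[OF Ck_on_has_derivative[OF Suc.prems(1)]
            Ck_on_has_derivative[OF Suc.prems(2)]]])
      (use Suc in auto)
qed

lemma Ck_on_bounded_linear:
  assumes "bounded_linear h" "open S" "Ck_on k S f"
  shows "Ck_on k S (\<lambda>x. h (f x))"
  using assms(3)
proof (induction k arbitrary: f)
  case 0
  then show ?case using bounded_linear.continuous_on[OF assms(1)] by auto
next
  case (Suc k)
  show ?case
    by (rule Ck_on_SucI[OF assms(2) bounded_linear.has_derivative[OF assms(1)
            Ck_on_has_derivative[OF Suc.prems(1)]]])
      (use Suc in auto)
qed

lemma Ck_on_bounded_bilinear:
  assumes "bounded_bilinear h" "open S" "Ck_on k S f" "Ck_on k S g"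
  shows "Ck_on k S (\<lambda>x. h (f x) (g x))"
  using assms(3,4)
proof (induction k arbitrary: f g)
  case 0
  then show ?case using bounded_bilinear.continuous_on[OF assms(1)] by auto
next
  case (Suc k)
  note D = Ck_on_has_derivative[OF Suc.prems(1)] Ck_on_has_derivative[OF Suc.prems(2)]
  \<comment> \<open>The product rule leaves undifferentiated factors, whose class
    \<open>Suc k\<close> has to be lowered to \<open>k\<close>.\<close>
  have "Ck_on k S (\<lambda>x. h (f x) (frechet_derivative g (at x) v) +
      h (frechet_derivative f (at x) v) (g x))" for v
    using Ck_on_SucD[OF Suc.prems(1)] Ck_on_SucD[OF Suc.prems(2)] Suc.prems
    by (intro Ck_on_add[OF assms(2)] Suc.IH) simp_all
  from Ck_on_SucI[OF assms(2) bounded_bilinear.FDERIV[OF assms(1) D] this] show ?case .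
qed

lemma Ck_on_open_cover:
  assumes "\<And>x. x \<in> S \<Longrightarrow> \<exists>T. open T \<and> x \<in> T \<and> Ck_on k T f"
  shows "Ck_on k S f"
  using assms
proof (induction k arbitrary: f)
  case 0
  then show ?case
    by (metis Ck_on.simps(1) continuous_at_imp_continuous_on continuous_on_eq_continuous_at)
next
  case (Suc k)
  have "f differentiable at x" if "x \<in> S" for x
    using Suc.prems[OF that] by auto
  moreover have "Ck_on k S (\<lambda>x. frechet_derivative f (at x) v)" for v
  proof (rule Suc.IH)
    fix x assume "x \<in> S"
    then obtain T where "open T" "x \<in> T" "Ck_on (Suc k) T f"
      using Suc.prems by blast
    then show "\<exists>T. open T \<and> x \<in> T \<and> Ck_on k T (\<lambda>x. frechet_derivative f (at x) v)"
      by auto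
  qed
  ultimately show ?case
    by simp
qed

text \<open>The derivative of 1/f again contains 1/f, so the result of order \<open>k\<close> is fed
  back into the derivative.\<close>

lemma Ck_on_inverse:
  fixes f :: "'e::real_normed_vector \<Rightarrow> real"
  assumes "open S" "Ck_on k S f" "\<And>x. x \<in> S \<Longrightarrow> f x \<noteq> 0"
  shows "Ck_on k S (\<lambda>x. inverse (f x))"
  using assms(2)
proof (induction k)
  case 0
  then show ?case using assms(3) by (auto intro: continuous_intros)
next
  case (Suc k)
  have "Ck_on k S (\<lambda>x. inverse (f x))"
    using Suc Ck_on_SucD by blast
  then have "Ck_on k S (\<lambda>x. - (inverse (f x) * frechet_derivative f (at x) v * inverse (f x)))" for v
    using Suc.prems
    by (intro Ck_on_bounded_linear[OF bounded_linear_minus[OF bounded_linear_ident]]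
        Ck_on_bounded_bilinear[OF bounded_bilinear_mult] assms(1)) auto
  from Ck_on_SucI[OF assms(1) Deriv.has_derivative_inverse[OF assms(3)
        Ck_on_has_derivative[OF Suc.prems]] this]
  show ?case .
qed

section \<open>Smooth functions vanishing on the nonpositive half-line\<close>

text \<open>The functions \<open>t\<^sup>-\<^sup>n exp (-1/t)\<close> form a family that is closed under differentiation up to linear
  combinations.\<close>

definition flat_exp :: "nat \<Rightarrow> real \<Rightarrow> real" where
  "flat_exp n t = (if t > 0 then exp (- inverse t) * inverse t ^ n else 0)"

text \<open>With s = 1/t, the single term s^(n+2)/(n+2)! bounds the exponential series from below.
  The two spare powers of s give order two in t, which makes the difference quotient at 0 tend to
  0.\<close>

lemma flat_exp_bound: "\<bar>flat_exp n t\<bar> \<le> fact (n + 2) * t\<^sup>2"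
proof (cases "t > 0")
  case True
  define s where "s = inverse t"
  have s: "s > 0" "t = inverse s"
    using True by (auto simp: s_def)
  have "s ^ (n + 2) / fact (n + 2) \<le> exp s"
  proof -
    have "(\<Sum>i\<in>{n+2}. s ^ i / fact i) \<le> (\<Sum>i. s ^ i / fact i)"
      using s summable_exp_generic[of s]
      by (intro sum_le_suminf) (auto simp: divide_inverse mult.commute)
    then show ?thesis
      by (simp add: exp_def divide_inverse mult.commute del: fact_Suc power_Suc)
  qed
  then have "s ^ n * s\<^sup>2 \<le> fact (n + 2) * exp s"
    by (simp add: field_simps power_add del: fact_Suc add_2_eq_Suc add_2_eq_Suc')
  then have "exp (- s) * s ^ n \<le> fact (n + 2) * (inverse s)\<^sup>2"
    using s by (simp add: exp_minus field_simps del: fact_Suc add_2_eq_Suc add_2_eq_Suc')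
  then show ?thesis
    using True s by (simp add: flat_exp_def s_def[symmetric])
qed (auto simp: flat_exp_def)

lemma flat_exp_DERIV:
  "(flat_exp n has_real_derivative flat_exp (n + 2) t - real n * flat_exp (n + 1) t) (at t)"
proof -
  consider "t > 0" | "t < 0" | "t = 0" by linarith
  then show ?thesis
  proof cases
    case 1
    have "((\<lambda>t. exp (- inverse t) * inverse t ^ n) has_real_derivative
        flat_exp (n + 2) t - real n * flat_exp (n + 1) t) (at t)"
    proof -
      have "((\<lambda>t. exp (- inverse t) * inverse t ^ n) has_real_derivative
        exp (- inverse t) * (inverse t * inverse t) * inverse t ^ n +
        exp (- inverse t) * (real n * inverse t ^ (n - 1) * - (inverse t * inverse t))) (at t)"
        using 1 by (auto intro!: derivative_eq_intros)
      \<comment> \<open>For \<open>n = 0\<close> the exponent is truncated to 0, and the factor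
        \<open>real n\<close> removes the term.\<close>
      moreover have "real n * inverse t ^ (n - 1) * - (inverse t * inverse t) =
          - (real n * inverse t ^ (n + 1))"
        by (cases n) auto
      moreover have "exp (- inverse t) * (inverse t * inverse t) * inverse t ^ n +
          exp (- inverse t) * - (real n * inverse t ^ (n + 1)) =
          flat_exp (n + 2) t - real n * flat_exp (n + 1) t"
        using 1 by (simp add: flat_exp_def algebra_simps)
      ultimately show ?thesis
        by (simp only:)
    qed
    then show ?thesis
      by (rule has_field_derivative_transform_within_open[where S = "{0<..}"])
        (use 1 in \<open>auto simp: flat_exp_def\<close>)
  next
    case 2
    have "((\<lambda>t. 0) has_real_derivative flat_exp (n + 2) t - real n * flat_exp (n + 1) t) (at t)"
      using 2 by (auto simp: flat_exp_def)
    then show ?thesis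
      by (rule has_field_derivative_transform_within_open[where S = "{..<0}"])
        (use 2 in \<open>auto simp: flat_exp_def\<close>)
  next
    case 3
    have "((\<lambda>h. flat_exp n h / h) \<longlongrightarrow> 0) (at 0)"
    proof (rule tendsto_0_le[where K = 1])
      show "((\<lambda>h. fact (n + 2) * h) \<longlongrightarrow> (0::real)) (at 0)"
        by (auto intro!: tendsto_eq_intros)
      show "\<forall>\<^sub>F h in at 0. norm (flat_exp n h / h) \<le> norm (fact (n + 2) * h) * 1"
      proof (rule always_eventually, rule allI)
        fix h :: real
        have "\<bar>flat_exp n h\<bar> \<le> fact (n + 2) * \<bar>h\<bar> * \<bar>h\<bar>"
          using flat_exp_bound[of n h] by (simp add: power2_eq_square mult.assoc del: fact_Suc)
        then show "norm (flat_exp n h / h) \<le> norm (fact (n + 2) * h) * 1"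
          by (cases "h = 0") (simp_all add: pos_divide_le_eq abs_mult del: fact_Suc)
      qed
    qed
    then show ?thesis
      using 3 by (simp add: DERIV_def flat_exp_def)
  qed
qed

text \<open>Each differentiation raises \<open>n\<close> by one or two, hence the induction over
  \<open>k\<close> for all \<open>n\<close> at once. With the inner map \<open>g\<close> built in,
  derivatives involve only sums and products of this family with derivatives of
  \<open>g\<close>.\<close>

lemma Ck_on_flat_exp:
  assumes "open S" "Ck_on k S g"
  shows "Ck_on k S (\<lambda>x. flat_exp n (g x))"
  using assms(2)
proof (induction k arbitrary: n)
  case 0
  have "continuous_on UNIV (flat_exp n)"
    using flat_exp_DERIV DERIV_isCont continuous_at_imp_continuous_on by blast
  then show ?case
    using 0 continuous_on_compose2[of UNIV "flat_exp n" S g] by auto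
next
  case (Suc k)
  have IH: "Ck_on k S (\<lambda>x. flat_exp m (g x))" for m
    using Suc Ck_on_SucD by blast
  have D: "((\<lambda>x. flat_exp n (g x)) has_derivative
      (\<lambda>v. (flat_exp (n + 2) (g x) + (- real n) * flat_exp (n + 1) (g x)) *
        frechet_derivative g (at x) v)) (at x)" if "x \<in> S" for x
    using has_derivative_compose[OF Ck_on_has_derivative[OF Suc.prems that]
        flat_exp_DERIV[of n "g x", unfolded has_field_derivative_def]]
    by simp
  have "Ck_on k S (\<lambda>x. (flat_exp (n + 2) (g x) + (- real n) * flat_exp (n + 1) (g x)) *
      frechet_derivative g (at x) v)" for v
    by (intro Ck_on_bounded_bilinear[OF bounded_bilinear_mult] Ck_on_add Ck_on_const assms(1) IH)
      (use Suc.prems in auto)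
  from Ck_on_SucI[OF assms(1) D this] show ?case .
qed

section \<open>Closure properties of \<open>smooth_on\<close>\<close>

lemma smooth_on_subset: "smooth_on S f \<Longrightarrow> T \<subseteq> S \<Longrightarrow> smooth_on T f"
  by (auto simp: smooth_on_def intro: Ck_on_subset)

lemma smooth_on_cong:
  "open S \<Longrightarrow> smooth_on S f \<Longrightarrow> (\<And>x. x \<in> S \<Longrightarrow> f x = g x) \<Longrightarrow> smooth_on S g"
  unfolding smooth_on_def using Ck_on_cong by blast

lemma smooth_on_const: "open S \<Longrightarrow> smooth_on S (\<lambda>x. c)"
  by (simp add: smooth_on_def Ck_on_const)

lemma smooth_on_add:
  "open S \<Longrightarrow> smooth_on S f \<Longrightarrow> smooth_on S g \<Longrightarrow> smooth_on S (\<lambda>x. f x + g x)"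
  by (simp add: smooth_on_def Ck_on_add)

lemma smooth_on_bounded_linear:
  "bounded_linear h \<Longrightarrow> open S \<Longrightarrow> smooth_on S f \<Longrightarrow> smooth_on S (\<lambda>x. h (f x))"
  by (simp add: smooth_on_def Ck_on_bounded_linear)

lemma smooth_on_bounded_bilinear:
  "bounded_bilinear h \<Longrightarrow> open S \<Longrightarrow> smooth_on S f \<Longrightarrow> smooth_on S g \<Longrightarrow>
    smooth_on S (\<lambda>x. h (f x) (g x))"
  by (simp add: smooth_on_def Ck_on_bounded_bilinear)

lemma smooth_on_inverse:
  fixes f :: "'e::real_normed_vector \<Rightarrow> real"
  shows "open S \<Longrightarrow> smooth_on S f \<Longrightarrow> (\<And>x. x \<in> S \<Longrightarrow> f x \<noteq> 0) \<Longrightarrow> smooth_on S (\<lambda>x. inverse (f x))"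
  by (simp add: smooth_on_def Ck_on_inverse)

lemma smooth_on_flat_exp: "open S \<Longrightarrow> smooth_on S g \<Longrightarrow> smooth_on S (\<lambda>x. flat_exp n (g x))"
  by (simp add: smooth_on_def Ck_on_flat_exp)

lemma smooth_on_open_cover:
  assumes "\<And>x. x \<in> S \<Longrightarrow> \<exists>T. open T \<and> x \<in> T \<and> smooth_on T f"
  shows "smooth_on S f"
  unfolding smooth_on_def
proof
  fix k
  show "Ck_on k S f"
    by (rule Ck_on_open_cover) (use assms smooth_on_def in blast)
qed

lemma smooth_on_imp_continuous_on: "smooth_on S f \<Longrightarrow> continuous_on S f"
  unfolding smooth_on_def using Ck_on.simps(1) by blast

lemma smooth_on_sum:
  assumes "open S" "\<And>i. i \<in> I \<Longrightarrow> smooth_on S (f i)"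
  shows "smooth_on S (\<lambda>x. \<Sum>i\<in>I. f i x)"
  using assms(2)
  by (induction I rule: infinite_finite_induct) (auto simp: smooth_on_const smooth_on_add assms(1))

lemma smooth_on_mult:
  fixes f g :: "'e::real_normed_vector \<Rightarrow> real"
  shows "open S \<Longrightarrow> smooth_on S f \<Longrightarrow> smooth_on S g \<Longrightarrow> smooth_on S (\<lambda>x. f x * g x)"
  by (rule smooth_on_bounded_bilinear[OF bounded_bilinear_mult])

lemma smooth_on_diff:
  assumes "open S" "smooth_on S f" "smooth_on S g"
  shows "smooth_on S (\<lambda>x. f x - g x)"
  using smooth_on_add[OF assms(1,2) smooth_on_bounded_linear[OF
      bounded_linear_minus[OF bounded_linear_ident] assms(1,3)]]
  by simp

text \<open>Gaussian elimination, with the pivot chosen locally.\<close>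

lemma smooth_on_linear_system:
  fixes M :: "'i \<Rightarrow> 'j \<Rightarrow> 'e::real_normed_vector \<Rightarrow> real"
  assumes "finite I" "open S"
    and "\<And>i j. i \<in> I \<Longrightarrow> j \<in> J \<Longrightarrow> smooth_on S (M i j)"
    and "\<And>j. j \<in> J \<Longrightarrow> smooth_on S (a j)"
    and "\<And>x j. x \<in> S \<Longrightarrow> j \<in> J \<Longrightarrow> (\<Sum>i\<in>I. y i x * M i j x) = a j x"
    and "\<And>x c i. x \<in> S \<Longrightarrow> (\<And>j. j \<in> J \<Longrightarrow> (\<Sum>i\<in>I. c i * M i j x) = 0) \<Longrightarrow> i \<in> I \<Longrightarrow> c i = 0"
    and "i \<in> I"
  shows "smooth_on S (y i)"
  using assms
proof (induction I arbitrary: S M a i rule: finite_induct)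
  case empty
  then show ?case by simp
next
  case (insert i0 I)
  note op = insert.prems(1) and M = insert.prems(2) and a = insert.prems(3)
    and eq = insert.prems(4) and inj = insert.prems(5)
  show ?case
  proof (rule smooth_on_open_cover)
    fix x0 assume x0: "x0 \<in> S"
    \<comment> \<open>If all coefficients of the unknown \<open>i0\<close> vanished at
      \<open>x0\<close>, the unit vector at \<open>i0\<close> would lie in the kernel.\<close>
    have "\<exists>j\<in>J. M i0 j x0 \<noteq> 0"
    proof (rule ccontr)
      assume "\<not> ?thesis"
      then have "(\<Sum>i\<in>insert i0 I. (if i = i0 then 1 else 0) * M i j x0) = 0" if "j \<in> J" for j
        using that by (intro sum.neutral) auto
      from inj[OF x0 this, of i0] show False by simp
    qed
    then obtain j0 where j0: "j0 \<in> J" "M i0 j0 x0 \<noteq> 0" by blast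
    \<comment> \<open>The pivot is fixed only near \<open>x0\<close>, as no single coefficient need
      stay nonzero on all of \<open>S\<close>.\<close>
    define T where "T = {x \<in> S. M i0 j0 x \<noteq> 0}"
    have "open (M i0 j0 -` (- {0}) \<inter> S)"
      using continuous_on_open_vimage[OF op] smooth_on_imp_continuous_on[OF M[of i0 j0]] j0
      by blast
    moreover have "M i0 j0 -` (- {0}) \<inter> S = T"
      by (auto simp: T_def)
    ultimately have T: "open T" "T \<subseteq> S" "x0 \<in> T"
      using j0 x0 by (auto simp: T_def)
    have MT: "smooth_on T (M i j)" if "i \<in> insert i0 I" "j \<in> J" for i j
      using M[OF that] T smooth_on_subset by blast
    have aT: "smooth_on T (a j)" if "j \<in> J" for j
      using a[OF that] T smooth_on_subset by blast
    have inv: "smooth_on T (\<lambda>x. inverse (M i0 j0 x))"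
      by (rule smooth_on_inverse[OF T(1) MT]) (auto simp: T_def j0)
    \<comment> \<open>Equation \<open>j0\<close>, times the quotient of the coefficients of
      \<open>i0\<close>, is subtracted from equation \<open>j\<close>; the unknown \<open>i0\<close>
      drops out.\<close>
    define M' where "M' i j x = M i j x - M i j0 x * (M i0 j x * inverse (M i0 j0 x))" for i j x
    define a' where "a' j x = a j x - a j0 x * (M i0 j x * inverse (M i0 j0 x))" for j x
    have M'_eq: "(\<Sum>i\<in>I. c i * M' i j x) =
        (\<Sum>i\<in>I. c i * M i j x) - (\<Sum>i\<in>I. c i * M i j0 x) * (M i0 j x * inverse (M i0 j0 x))"
      for c j x
      by (simp add: M'_def right_diff_distrib sum_subtractf sum_distrib_right mult.assoc)
    have y: "smooth_on T (y i)" if "i \<in> I" for i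
    proof (rule insert.IH[of T M' a'])
      show "smooth_on T (M' i j)" if "i \<in> I" "j \<in> J" for i j
        unfolding M'_def[abs_def]
        using that j0 by (intro smooth_on_diff smooth_on_mult T inv MT) auto
      show "smooth_on T (a' j)" if "j \<in> J" for j
        unfolding a'_def[abs_def]
        using that j0 by (intro smooth_on_diff smooth_on_mult T inv MT aT) auto
      show "(\<Sum>i\<in>I. y i x * M' i j x) = a' j x" if "x \<in> T" "j \<in> J" for x j
      proof -
        have s: "(\<Sum>i\<in>I. y i x * M i j' x) = a j' x - y i0 x * M i0 j' x" if "j' \<in> J" for j'
          using eq[of x j'] that \<open>x \<in> T\<close> insert.hyps T(2) by auto
        show ?thesis
          unfolding M'_eq a'_def s[OF that(2)] s[OF j0(1)]
          using that(1) by (simp add: T_def field_simps)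
      qed
      show "c i = 0" if "x \<in> T" "\<And>j. j \<in> J \<Longrightarrow> (\<Sum>i\<in>I. c i * M' i j x) = 0" "i \<in> I" for x c i
      proof -
        \<comment> \<open>The value at \<open>i0\<close> solves the pivot equation, so a kernel
          vector of the reduced system extends to one of the full system.\<close>
        define c' where "c' i = (if i = i0 then - (\<Sum>i\<in>I. c i * M i j0 x) * inverse (M i0 j0 x) else c i)" for i
        have "(\<Sum>i\<in>I. c' i * M i j x) = (\<Sum>i\<in>I. c i * M i j x)" for j
          by (rule sum.cong) (use insert.hyps in \<open>auto simp: c'_def\<close>)
        then have "(\<Sum>i\<in>insert i0 I. c' i * M i j x) = 0" if "j \<in> J" for j
          using insert.hyps \<open>\<And>j. j \<in> J \<Longrightarrow> (\<Sum>i\<in>I. c i * M' i j x) = 0\<close>[OF that, unfolded M'_eq]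
          by (simp add: c'_def algebra_simps)
        from inj[of x c' i, OF _ this] show ?thesis
          using that T insert.hyps by (auto simp: c'_def split: if_splits)
      qed
    qed (use that T in auto)
    \<comment> \<open>Back substitution in the pivot equation.\<close>
    have "smooth_on T (\<lambda>x. (a j0 x - (\<Sum>i\<in>I. y i x * M i j0 x)) * inverse (M i0 j0 x))"
      using j0 by (intro smooth_on_diff smooth_on_mult smooth_on_sum T inv MT aT y) auto
    then have "smooth_on T (y i0)"
    proof (rule smooth_on_cong[OF T(1)])
      fix x assume x: "x \<in> T"
      have "(\<Sum>i\<in>I. y i x * M i j0 x) = a j0 x - y i0 x * M i0 j0 x"
        using eq[of x j0] j0 x insert.hyps T(2) by auto
      then show "(a j0 x - (\<Sum>i\<in>I. y i x * M i j0 x)) * inverse (M i0 j0 x) = y i0 x"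
        using x by (simp add: T_def)
    qed
    then show "\<exists>T. open T \<and> x0 \<in> T \<and> smooth_on T (y i)"
      using y insert.prems(6) T by blast
  qed
qed

section \<open>Finite-dimensional inner product spaces\<close>

text \<open>Takes the part of \<open>Basis\<close>, but may be empty, so that the zero space is
  covered.\<close>

definition orthonormal_frame :: "'f::real_inner set \<Rightarrow> bool" where
  "orthonormal_frame E \<longleftrightarrow> finite E \<and> (\<forall>i\<in>E. \<forall>j\<in>E. i \<bullet> j = (if i = j then 1 else 0)) \<and>
     (\<forall>v. (\<Sum>i\<in>E. (v \<bullet> i) *\<^sub>R i) = v)"

lemma finite_dimensional_frame:
  assumes "finite_dimensional TYPE('f)"
  obtains E :: "'f::real_inner set" where "orthonormal_frame E"
proof -
  obtain b :: "'f set" where b: "finite b" "span b = UNIV"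
    using assms by (auto simp: finite_dimensional_def)
  obtain C :: "'f set" where C: "finite C" "span C = UNIV" "pairwise orthogonal C"
    using basis_orthogonal[OF b(1)] b(2) by auto
  \<comment> \<open>Pairwise orthogonality allows \<open>0\<close> in \<open>C\<close>, which cannot
    be normalised.\<close>
  define E where "E = (\<lambda>x. x /\<^sub>R norm x) ` (C - {0})"
  have fin: "finite E"
    using C by (simp add: E_def)
  have on: "i \<bullet> j = (if i = j then 1 else 0)" if ij: "i \<in> E" "j \<in> E" for i j
  proof -
    obtain x y where xy: "x \<in> C" "x \<noteq> 0" "i = x /\<^sub>R norm x" "y \<in> C" "y \<noteq> 0" "j = y /\<^sub>R norm y"
      using ij by (auto simp: E_def)
    show ?thesis
    proof (cases "x = y")
      case True
      then show ?thesis
        using xy dot_square_norm[of i] by simp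
    next
      case False
      then have "i \<bullet> j = 0"
        using xy C(3) by (simp add: pairwise_def orthogonal_def)
      moreover have "norm i = 1"
        using xy by simp
      ultimately show ?thesis
        by auto
    qed
  qed
  have "C \<subseteq> span E"
  proof
    fix x assume x: "x \<in> C"
    show "x \<in> span E"
    proof (cases "x = 0")
      case True
      then show ?thesis by (simp add: span_zero)
    next
      case False
      then have "norm x *\<^sub>R (x /\<^sub>R norm x) \<in> span E"
        using x by (intro span_scale span_base) (auto simp: E_def)
      then show ?thesis
        using False by simp
    qed
  qed
  then have "span E = UNIV"
    using C(2) span_minimal[of C "span E"] by auto
  have "(\<Sum>i\<in>E. (v \<bullet> i) *\<^sub>R i) = v" for v
  proof -
    obtain c where c: "v = (\<Sum>i\<in>E. c i *\<^sub>R i)"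
      using \<open>span E = UNIV\<close> span_finite[OF fin] by auto
    have "v \<bullet> j = c j" if "j \<in> E" for j
    proof -
      have "v \<bullet> j = (\<Sum>i\<in>E. if i = j then c i else 0)"
        unfolding c inner_sum_left by (rule sum.cong) (use on that in auto)
      then show ?thesis
        using fin that by simp
    qed
    then show ?thesis
      using c by simp
  qed
  then show ?thesis
    using that fin on by (auto simp: orthonormal_frame_def)
qed

text \<open>The ball is closed and lies in a cube along the frame, and the cube is a finite sum of
  compact segments.\<close>

lemma compact_cball_finite_dimensional:
  fixes x :: "'e::real_inner"
  assumes "finite_dimensional TYPE('e)"
  shows "compact (cball x r)"
proof -
  obtain E :: "'e set" where E: "orthonormal_frame E"
    using finite_dimensional_frame[OF assms] .
  \<comment> \<open>Every point of the ball has norm at most \<open>R\<close>, and by Cauchy-Schwarz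
    this bounds its coordinates in the frame.\<close>
  define R where "R = norm x + r"
  have box: "compact {\<Sum>i\<in>F. c i *\<^sub>R i | c. \<forall>i\<in>F. \<bar>c i\<bar> \<le> R}" if "finite F" for F :: "'e set"
    using that
  proof (induction F)
    case empty
    then show ?case by simp
  next
    case (insert j F)
    let ?K = "{\<Sum>i\<in>F. c i *\<^sub>R i | c. \<forall>i\<in>F. \<bar>c i\<bar> \<le> R}"
    have "compact ((\<lambda>t. t *\<^sub>R j) ` {-R..R})"
      by (intro compact_continuous_image continuous_intros) simp
    then have "compact {u + v | u v. u \<in> (\<lambda>t. t *\<^sub>R j) ` {-R..R} \<and> v \<in> ?K}"
      by (rule compact_sums) (rule insert.IH)
    also have "{u + v | u v. u \<in> (\<lambda>t. t *\<^sub>R j) ` {-R..R} \<and> v \<in> ?K} =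
        {\<Sum>i\<in>insert j F. c i *\<^sub>R i | c. \<forall>i\<in>insert j F. \<bar>c i\<bar> \<le> R}" (is "?A = ?B")
    proof
      show "?A \<subseteq> ?B"
      proof
        fix z assume "z \<in> ?A"
        then obtain t c where z: "z = t *\<^sub>R j + (\<Sum>i\<in>F. c i *\<^sub>R i)" "\<bar>t\<bar> \<le> R" "\<forall>i\<in>F. \<bar>c i\<bar> \<le> R"
          by (auto simp: abs_le_iff)
        have "(\<Sum>i\<in>F. (c(j := t)) i *\<^sub>R i) = (\<Sum>i\<in>F. c i *\<^sub>R i)"
          by (rule sum.cong) (use insert.hyps in auto)
        then show "z \<in> ?B"
          using z insert.hyps by (intro CollectI exI[of _ "c(j := t)"]) auto
      qed
      show "?B \<subseteq> ?A"
        using insert.hyps by (fastforce simp: abs_le_iff)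
    qed
    finally show ?case .
  qed
  have "cball x r \<subseteq> {\<Sum>i\<in>E. c i *\<^sub>R i | c. \<forall>i\<in>E. \<bar>c i\<bar> \<le> R}"
  proof
    fix v assume "v \<in> cball x r"
    then have "norm v \<le> R"
      using norm_triangle_ineq2[of v x] by (simp add: R_def dist_norm norm_minus_commute)
    moreover have "\<bar>v \<bullet> i\<bar> \<le> norm v" if "i \<in> E" for i
    proof -
      have "norm i = 1"
        using E that by (simp add: orthonormal_frame_def norm_eq_sqrt_inner)
      then show ?thesis
        using Cauchy_Schwarz_ineq2[of v i] by simp
    qed
    ultimately show "v \<in> {\<Sum>i\<in>E. c i *\<^sub>R i | c. \<forall>i\<in>E. \<bar>c i\<bar> \<le> R}"
      using E by (intro CollectI exI[of _ "\<lambda>i. v \<bullet> i"]) (auto simp: orthonormal_frame_def intro: order_trans)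
  qed
  then show ?thesis
    using compact_Int_closed[OF box closed_cball, of E x r] E
    by (simp add: orthonormal_frame_def Int_absorb1)
qed

section \<open>Smooth maps on manifolds\<close>

context
  fixes M :: "('m::{t2_space,second_countable_topology}, 'e::real_inner, 'z) manifold_scheme"
  assumes M: "smooth_manifold M"
begin

lemma chart_open: "(V, \<phi>) \<in> charts M \<Longrightarrow> open V"
  and chart_homeomorphism: "(V, \<phi>) \<in> charts M \<Longrightarrow> homeomorphism V (\<phi> ` V) \<phi> (inv_into V \<phi>)"
  using M by (auto simp: smooth_manifold_def)

lemma chart_open_image:
  assumes "(V, \<phi>) \<in> charts M" "open U"
  shows "open (\<phi> ` (U \<inter> V))"
proof -
  have "openin (top_of_set V) (U \<inter> V)"
    using assms(2) by (auto simp: openin_open)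
  then have "openin (top_of_set (\<phi> ` V)) (\<phi> ` (U \<inter> V))"
    using homeomorphism_imp_open_map[OF chart_homeomorphism[OF assms(1)]] by blast
  moreover have "open (\<phi> ` V)"
    using M assms(1) by (auto simp: smooth_manifold_def)
  ultimately show ?thesis
    using openin_open_eq by blast
qed

lemma chart_inverse: "(V, \<phi>) \<in> charts M \<Longrightarrow> p \<in> V \<Longrightarrow> inv_into V \<phi> (\<phi> p) = p"
  using homeomorphism_apply1[OF chart_homeomorphism] .

lemma msmooth_on_subset:
  assumes "msmooth_on M U f" "W \<subseteq> U"
  shows "msmooth_on M W f"
  unfolding msmooth_on_def
proof clarify
  fix V \<phi> assume "(V, \<phi>) \<in> charts M"
  then have "smooth_on (\<phi> ` (U \<inter> V)) (\<lambda>x. f (inv_into V \<phi> x))"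
    using assms(1) by (auto simp: msmooth_on_def)
  then show "smooth_on (\<phi> ` (W \<inter> V)) (\<lambda>x. f (inv_into V \<phi> x))"
    by (rule smooth_on_subset) (use assms(2) in blast)
qed

lemma msmooth_on_cong:
  assumes "open U" "msmooth_on M U f" "\<And>p. p \<in> U \<Longrightarrow> f p = g p"
  shows "msmooth_on M U g"
  unfolding msmooth_on_def
proof clarify
  fix V \<phi> assume V: "(V, \<phi>) \<in> charts M"
  then have "smooth_on (\<phi> ` (U \<inter> V)) (\<lambda>x. f (inv_into V \<phi> x))"
    using assms(2) by (auto simp: msmooth_on_def)
  then show "smooth_on (\<phi> ` (U \<inter> V)) (\<lambda>x. g (inv_into V \<phi> x))"
    by (rule smooth_on_cong[OF chart_open_image[OF V assms(1)]])
      (auto simp: chart_inverse[OF V] assms(3))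
qed

lemma msmooth_on_const: "open U \<Longrightarrow> msmooth_on M U (\<lambda>p. c)"
  by (auto simp: msmooth_on_def chart_open_image intro!: smooth_on_const)

lemma msmooth_on_sum:
  assumes "open U" "\<And>i. i \<in> I \<Longrightarrow> msmooth_on M U (f i)"
  shows "msmooth_on M U (\<lambda>p. \<Sum>i\<in>I. f i p)"
  unfolding msmooth_on_def
proof clarify
  fix V \<phi> assume V: "(V, \<phi>) \<in> charts M"
  show "smooth_on (\<phi> ` (U \<inter> V)) (\<lambda>x. \<Sum>i\<in>I. f i (inv_into V \<phi> x))"
    by (rule smooth_on_sum) (use assms V chart_open_image in \<open>auto simp: msmooth_on_def\<close>)
qed

lemma msmooth_on_bounded_linear:
  assumes "open U" "bounded_linear h" "msmooth_on M U f"
  shows "msmooth_on M U (\<lambda>p. h (f p))"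
  unfolding msmooth_on_def
proof clarify
  fix V \<phi> assume V: "(V, \<phi>) \<in> charts M"
  show "smooth_on (\<phi> ` (U \<inter> V)) (\<lambda>x. h (f (inv_into V \<phi> x)))"
    by (rule smooth_on_bounded_linear[OF assms(2)])
      (use assms V chart_open_image in \<open>auto simp: msmooth_on_def\<close>)
qed

lemma msmooth_on_bounded_bilinear:
  assumes "open U" "bounded_bilinear h" "msmooth_on M U f" "msmooth_on M U g"
  shows "msmooth_on M U (\<lambda>p. h (f p) (g p))"
  unfolding msmooth_on_def
proof clarify
  fix V \<phi> assume V: "(V, \<phi>) \<in> charts M"
  show "smooth_on (\<phi> ` (U \<inter> V)) (\<lambda>x. h (f (inv_into V \<phi> x)) (g (inv_into V \<phi> x)))"
    by (rule smooth_on_bounded_bilinear[OF assms(2)])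
      (use assms V chart_open_image in \<open>auto simp: msmooth_on_def\<close>)
qed

lemmas msmooth_on_mult = msmooth_on_bounded_bilinear[OF _ bounded_bilinear_mult]
lemmas msmooth_on_scaleR = msmooth_on_bounded_bilinear[OF _ bounded_bilinear_scaleR]
lemmas msmooth_on_inner = msmooth_on_bounded_linear[OF _ bounded_linear_inner_left]

text \<open>Gluing over open sets; this is what permits extension by zero.\<close>

lemma msmooth_on_Un:
  assumes "open U" "open W" "msmooth_on M U f" "msmooth_on M W f"
  shows "msmooth_on M (U \<union> W) f"
  unfolding msmooth_on_def
proof clarify
  fix V \<phi> assume V: "(V, \<phi>) \<in> charts M"
  show "smooth_on (\<phi> ` ((U \<union> W) \<inter> V)) (\<lambda>x. f (inv_into V \<phi> x))"
  proof (rule smooth_on_open_cover)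
    fix x assume "x \<in> \<phi> ` ((U \<union> W) \<inter> V)"
    then have "x \<in> \<phi> ` (U \<inter> V) \<or> x \<in> \<phi> ` (W \<inter> V)"
      by blast
    moreover have "smooth_on (\<phi> ` (U \<inter> V)) (\<lambda>x. f (inv_into V \<phi> x))"
      "smooth_on (\<phi> ` (W \<inter> V)) (\<lambda>x. f (inv_into V \<phi> x))"
      using assms(3,4) V by (auto simp: msmooth_on_def)
    ultimately show "\<exists>T. open T \<and> x \<in> T \<and> smooth_on T (\<lambda>x. f (inv_into V \<phi> x))"
      using chart_open_image[OF V] assms(1,2) by blast
  qed
qed

lemma msmooth_on_linear_system:
  fixes m :: "'i \<Rightarrow> 'j \<Rightarrow> 'm \<Rightarrow> real"
  assumes "finite I" "open U"
    and "\<And>i j. i \<in> I \<Longrightarrow> j \<in> J \<Longrightarrow> msmooth_on M U (m i j)"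
    and "\<And>j. j \<in> J \<Longrightarrow> msmooth_on M U (a j)"
    and "\<And>p j. p \<in> U \<Longrightarrow> j \<in> J \<Longrightarrow> (\<Sum>i\<in>I. y i p * m i j p) = a j p"
    and "\<And>p c i. p \<in> U \<Longrightarrow> (\<And>j. j \<in> J \<Longrightarrow> (\<Sum>i\<in>I. c i * m i j p) = 0) \<Longrightarrow> i \<in> I \<Longrightarrow> c i = 0"
    and "i \<in> I"
  shows "msmooth_on M U (y i)"
  unfolding msmooth_on_def
proof clarify
  fix V \<phi> assume V: "(V, \<phi>) \<in> charts M"
  have U: "inv_into V \<phi> x \<in> U" if "x \<in> \<phi> ` (U \<inter> V)" for x
    using that chart_inverse[OF V] by auto
  show "smooth_on (\<phi> ` (U \<inter> V)) (\<lambda>x. y i (inv_into V \<phi> x))"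
  proof (rule smooth_on_linear_system[where I = I and J = J
        and M = "\<lambda>i j x. m i j (inv_into V \<phi> x)" and a = "\<lambda>j x. a j (inv_into V \<phi> x)"
        and y = "\<lambda>i x. y i (inv_into V \<phi> x)"])
    show "smooth_on (\<phi> ` (U \<inter> V)) (\<lambda>x. m i j (inv_into V \<phi> x))" if "i \<in> I" "j \<in> J" for i j
      using assms(3)[OF that] V by (auto simp: msmooth_on_def)
    show "smooth_on (\<phi> ` (U \<inter> V)) (\<lambda>x. a j (inv_into V \<phi> x))" if "j \<in> J" for j
      using assms(4)[OF that] V by (auto simp: msmooth_on_def)
    show "(\<Sum>i\<in>I. y i (inv_into V \<phi> x) * m i j (inv_into V \<phi> x)) = a j (inv_into V \<phi> x)"
      if "x \<in> \<phi> ` (U \<inter> V)" "j \<in> J" for x j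
      using assms(5)[OF U that(2)] that(1) .
    show "c i = 0" if "x \<in> \<phi> ` (U \<inter> V)"
      "\<And>j. j \<in> J \<Longrightarrow> (\<Sum>i\<in>I. c i * m i j (inv_into V \<phi> x)) = 0" "i \<in> I" for x c i
      using assms(6)[OF U that(2,3)] that(1) .
  qed (use assms(1,7) chart_open_image[OF V assms(2)] in auto)
qed

end


section \<open>Local trivialisations\<close>

text \<open>One frame for the model fibre, chosen once, so that no coordinate formula has to carry
  it as a parameter.\<close>

definition std_frame :: "'f::real_inner set" where
  "std_frame = (SOME E. orthonormal_frame E)"

lemma std_frame:
  "finite_dimensional TYPE('f) \<Longrightarrow> orthonormal_frame (std_frame :: 'f::real_inner set)"
  unfolding std_frame_def by (metis finite_dimensional_frame someI_ex)

text \<open>The case \<open>I = {}\<close> reads \<open>f 0 = 0\<close> and is used in that form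
  too.\<close>

lemma linear_on_sum:
  assumes "linear_on V f" "subspace V" "\<And>i. i \<in> I \<Longrightarrow> x i \<in> V"
  shows "f (\<Sum>i\<in>I. c i *\<^sub>R x i) = (\<Sum>i\<in>I. c i *\<^sub>R f (x i))"
proof -
  have 0: "f 0 = 0"
  proof -
    have "f (0 *\<^sub>R 0) = 0 *\<^sub>R f 0"
      using assms(1) subspace_0[OF assms(2)] unfolding linear_on_def by blast
    then show ?thesis
      by simp
  qed
  show ?thesis
    using assms(3)
  proof (induction I rule: infinite_finite_induct)
    case (insert i I)
    have "(\<Sum>i\<in>I. c i *\<^sub>R x i) \<in> V" "c i *\<^sub>R x i \<in> V"
      using insert assms(2) by (auto intro!: subspace_sum subspace_scale)
    then show ?case
      using insert assms(1) by (simp add: linear_on_def)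
  qed (auto simp: 0)
qed

text \<open>Only the trivialisation \<open>\<Phi>\<close> is tested. Frame sections over
  \<open>U\<close> become admissible, and each bundle map can be treated in one trivialisation at a
  time.\<close>

definition local_section ::
  "('m, 'e::real_normed_vector, 'v, 'f::real_normed_vector, 'z) vbundle_scheme \<Rightarrow>
    'm set \<Rightarrow> ('m \<Rightarrow> 'v \<Rightarrow> 'f) \<Rightarrow> ('m \<Rightarrow> 'v) \<Rightarrow> bool" where
  "local_section A U \<Phi> x \<longleftrightarrow>
     (\<forall>p\<in>U. x p \<in> fibre A p) \<and> msmooth_on A U (\<lambda>p. \<Phi> p (x p))"

definition local_dual_section ::
  "('m, 'e::real_normed_vector, 'v::real_vector, 'f, 'z) vbundle_scheme \<Rightarrow>
    'm set \<Rightarrow> ('m \<Rightarrow> 'v \<Rightarrow> 'f) \<Rightarrow> ('m \<Rightarrow> 'v \<Rightarrow> real) \<Rightarrow> bool" where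
  "local_dual_section A U \<Phi> \<alpha> \<longleftrightarrow>
     (\<forall>p\<in>U. \<alpha> p \<in> dual_fibre A p) \<and> (\<forall>e. msmooth_on A U (\<lambda>p. \<alpha> p (triv_inv A \<Phi> p e)))"

lemma vector_bundle_cover:
  assumes "vector_bundle A"
  obtains U \<Phi> where "(U, \<Phi>) \<in> trivs A" "p \<in> U"
proof -
  have "p \<in> (\<Union>(U, \<Phi>)\<in>trivs A. U)"
    using assms by (simp add: vector_bundle_def)
  then show ?thesis
    using that by auto
qed

lemma sections_iff_local:
  assumes "vector_bundle A"
  shows "x \<in> sections A \<longleftrightarrow> (\<forall>(U, \<Phi>)\<in>trivs A. local_section A U \<Phi> x)"
proof
  assume "\<forall>(U, \<Phi>)\<in>trivs A. local_section A U \<Phi> x"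
  then have *: "local_section A U \<Phi> x" if "(U, \<Phi>) \<in> trivs A" for U \<Phi>
    using that by auto
  have "x p \<in> fibre A p" for p
  proof -
    obtain U \<Phi> where "(U, \<Phi>) \<in> trivs A" "p \<in> U"
      using vector_bundle_cover[OF assms] .
    with * show ?thesis
      unfolding local_section_def by blast
  qed
  with * show "x \<in> sections A"
    by (auto simp: sections_def local_section_def)
qed (auto simp: sections_def local_section_def)

lemma dual_sections_iff_local:
  assumes "vector_bundle A"
  shows "\<alpha> \<in> dual_sections A \<longleftrightarrow> (\<forall>(U, \<Phi>)\<in>trivs A. local_dual_section A U \<Phi> \<alpha>)"
proof
  assume "\<forall>(U, \<Phi>)\<in>trivs A. local_dual_section A U \<Phi> \<alpha>"
  then have *: "local_dual_section A U \<Phi> \<alpha>" if "(U, \<Phi>) \<in> trivs A" for U \<Phi>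
    using that by auto
  have "\<alpha> p \<in> dual_fibre A p" for p
  proof -
    obtain U \<Phi> where "(U, \<Phi>) \<in> trivs A" "p \<in> U"
      using vector_bundle_cover[OF assms] .
    with * show ?thesis
      unfolding local_dual_section_def by blast
  qed
  with * show "\<alpha> \<in> dual_sections A"
    by (auto simp: dual_sections_def local_dual_section_def)
qed (auto simp: dual_sections_def local_dual_section_def)

locale trivialised_bundle =
  fixes A :: "('m::{t2_space,second_countable_topology}, 'e::real_inner,
      'v::real_vector, 'f::real_inner, 'z) vbundle_scheme"
    and U :: "'m set" and \<Phi> :: "'m \<Rightarrow> 'v \<Rightarrow> 'f"
  assumes vb: "vector_bundle A" and triv: "(U, \<Phi>) \<in> trivs A"
begin

abbreviation E :: "'f set" where "E \<equiv> std_frame"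

abbreviation tinv :: "'m \<Rightarrow> 'f \<Rightarrow> 'v" where "tinv \<equiv> triv_inv A \<Phi>"

abbreviation coframe :: "'m \<Rightarrow> 'f \<Rightarrow> 'v \<Rightarrow> real" where
  "coframe p i \<equiv> pull A \<Phi> p (\<lambda>w. w \<bullet> i)"

lemma M: "smooth_manifold A" and fd: "finite_dimensional TYPE('f)"
  and sub: "subspace (fibre A p)" and open_U: "open U"
  and phi_linear: "p \<in> U \<Longrightarrow> linear_on (fibre A p) (\<Phi> p)"
  and phi_bij: "p \<in> U \<Longrightarrow> bij_betw (\<Phi> p) (fibre A p) UNIV"
  using vb triv by (auto simp: vector_bundle_def)

lemma frame: "finite E" "i \<in> E \<Longrightarrow> j \<in> E \<Longrightarrow> i \<bullet> j = (if i = j then 1 else 0)"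
  "(\<Sum>i\<in>E. (v \<bullet> i) *\<^sub>R i) = v"
  using std_frame[OF fd] by (auto simp: orthonormal_frame_def)

lemma tinv_fibre: "p \<in> U \<Longrightarrow> tinv p e \<in> fibre A p"
  and phi_tinv: "p \<in> U \<Longrightarrow> \<Phi> p (tinv p e) = e"
  and tinv_phi: "p \<in> U \<Longrightarrow> u \<in> fibre A p \<Longrightarrow> tinv p (\<Phi> p u) = u"
  using phi_bij[of p] unfolding triv_inv_def bij_betw_def
  by (simp_all add: inv_into_into f_inv_into_f inv_into_f_f)

lemma frame_expansion:
  assumes "p \<in> U" "u \<in> fibre A p"
  shows "(\<Sum>i\<in>E. (\<Phi> p u \<bullet> i) *\<^sub>R tinv p i) = u" (is "?s = u")
proof -
  have "\<Phi> p ?s = (\<Sum>i\<in>E. (\<Phi> p u \<bullet> i) *\<^sub>R \<Phi> p (tinv p i))"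
    by (rule linear_on_sum[OF phi_linear sub]) (use assms tinv_fibre in auto)
  also have "\<dots> = \<Phi> p u"
    by (simp add: phi_tinv assms(1) frame)
  finally have "\<Phi> p ?s = \<Phi> p u" .
  moreover have "?s \<in> fibre A p"
    by (intro subspace_sum subspace_scale sub tinv_fibre assms(1))
  ultimately show ?thesis
    using phi_bij[OF assms(1)] assms(2) by (auto simp: bij_betw_def inj_on_def)
qed

lemma linear_on_expansion:
  assumes "p \<in> U" "linear_on (fibre A p) h" "u \<in> fibre A p"
  shows "h u = (\<Sum>i\<in>E. (\<Phi> p u \<bullet> i) *\<^sub>R h (tinv p i))"
  using linear_on_sum[OF assms(2) sub, of E "tinv p" "\<lambda>i. \<Phi> p u \<bullet> i"] tinv_fibre[OF assms(1)]
    frame_expansion[OF assms(1,3)] by simp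

lemma pull_dual:
  assumes "p \<in> U" "linear \<epsilon>"
  shows "pull A \<Phi> p \<epsilon> \<in> dual_fibre A p"
  using phi_linear[OF assms(1)] assms(2) sub[of p]
  by (auto simp: pull_def dual_fibre_def linear_on_def linear_add[OF assms(2)]
      linear_scale[OF assms(2)] subspace_add subspace_scale)

lemma coframe_dual: "p \<in> U \<Longrightarrow> coframe p i \<in> dual_fibre A p"
  by (intro pull_dual bounded_linear.linear bounded_linear_inner_left)

lemma dual_fibre_linear: "\<alpha> \<in> dual_fibre A p \<Longrightarrow> linear_on (fibre A p) \<alpha>"
  by (simp add: dual_fibre_def)

text \<open>An equality of functions on all of \<open>'v\<close>: outside the fibre both sides are
  0. It can therefore be rewritten inside the arguments of a tensor.\<close>

lemma dual_expansion:
  assumes "p \<in> U" "\<alpha> \<in> dual_fibre A p"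
  shows "(\<lambda>u. \<Sum>i\<in>E. \<alpha> (tinv p i) * coframe p i u) = \<alpha>"
proof
  fix u
  show "(\<Sum>i\<in>E. \<alpha> (tinv p i) * coframe p i u) = \<alpha> u"
    using linear_on_expansion[OF assms(1) dual_fibre_linear[OF assms(2)], of u] assms(2)
    by (cases "u \<in> fibre A p") (auto simp: pull_def dual_fibre_def mult.commute)
qed

lemma fibre_eqI:
  assumes "p \<in> U" "u \<in> fibre A p" "v \<in> fibre A p" "\<And>\<beta>. \<beta> \<in> dual_fibre A p \<Longrightarrow> \<beta> u = \<beta> v"
  shows "u = v"
proof -
  have "\<Phi> p u \<bullet> i = \<Phi> p v \<bullet> i" for i
    using assms(4)[OF coframe_dual[OF assms(1), of i]] assms(2,3) by (simp add: pull_def)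
  then have "(\<Sum>i\<in>E. (\<Phi> p u \<bullet> i) *\<^sub>R tinv p i) = (\<Sum>i\<in>E. (\<Phi> p v \<bullet> i) *\<^sub>R tinv p i)"
    by (simp only:)
  then show ?thesis
    unfolding frame_expansion[OF assms(1,2)] frame_expansion[OF assms(1,3)] .
qed

text \<open>\<open>Sym2\<close> grants linearity in the first slot, and only for covectors of the
  fibre. Hence the passage through symmetry and the check that partial sums stay in
  \<open>dual_fibre\<close>.\<close>

lemma Sym2_sum:
  assumes "H \<in> Sym2 A" "p \<in> U" "\<alpha> \<in> dual_fibre A p" "\<beta> \<in> dual_fibre A p"
  shows "H p \<alpha> \<beta> = (\<Sum>i\<in>E. \<beta> (tinv p i) * H p \<alpha> (coframe p i))"
proof -
  have sym: "H p \<gamma> \<delta> = H p \<delta> \<gamma>"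
    and add: "H p (\<lambda>u. \<gamma> u + \<delta> u) \<alpha> = H p \<gamma> \<alpha> + H p \<delta> \<alpha>"
    and scale: "H p (\<lambda>u. c * \<gamma> u) \<alpha> = c * H p \<gamma> \<alpha>"
    if "\<gamma> \<in> dual_fibre A p" "\<delta> \<in> dual_fibre A p" for \<gamma> \<delta> c
    using assms(1,3) that by (auto simp: Sym2_def)
  have zero: "(\<lambda>u. 0) \<in> dual_fibre A p"
    by (simp add: dual_fibre_def linear_on_def)
  have cf: "(\<lambda>u. c * coframe p i u) \<in> dual_fibre A p" for c i
    using coframe_dual[OF assms(2), of i] by (auto simp: dual_fibre_def linear_on_def algebra_simps)
  have cfs: "(\<lambda>u. \<Sum>i\<in>F. c i * coframe p i u) \<in> dual_fibre A p" for c and F :: "'f set"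
  proof -
    have "coframe p i (u + v) = coframe p i u + coframe p i v"
      "coframe p i (d *\<^sub>R u) = d * coframe p i u"
      if "u \<in> fibre A p" "v \<in> fibre A p" for i u v d
      using coframe_dual[OF assms(2), of i] that by (auto simp: dual_fibre_def linear_on_def)
    then show ?thesis
      by (auto simp: dual_fibre_def linear_on_def sum.distrib sum_distrib_left algebra_simps
          pull_def)
  qed
  have "H p (\<lambda>u. \<Sum>i\<in>F. c i * coframe p i u) \<alpha> = (\<Sum>i\<in>F. c i * H p \<alpha> (coframe p i))"
    if "finite F" for c and F :: "'f set"
    using that
  proof (induction F)
    case empty
    show ?case
      using scale[OF zero zero, of 0] by simp
  next
    case (insert j F)
    then show ?case
      using add[OF cf cfs, of "c j" j c F] scale[OF coframe_dual[OF assms(2)] zero]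
        sym[OF coframe_dual[OF assms(2)] assms(3)]
      by simp
  qed
  from this[OF frame(1), of "\<lambda>i. \<beta> (tinv p i)"] show ?thesis
    unfolding dual_expansion[OF assms(2,4)] using sym[OF assms(4,3)] by simp
qed

text \<open>In finite dimension a functional on the dual fibre is evaluation at a vector, here
  written out in the frame. This gives existence for the definite description in
  \<open>sharp\<close>; uniqueness holds because the coframe separates vectors.\<close>

lemma sharp_formula:
  assumes "H \<in> Sym2 A" "p \<in> U" "\<alpha> \<in> dual_fibre A p"
  shows "sharp A H p \<alpha> = (\<Sum>i\<in>E. H p \<alpha> (coframe p i) *\<^sub>R tinv p i)" (is "_ = ?s")
    and "sharp A H p \<alpha> \<in> fibre A p"
    and "\<beta> \<in> dual_fibre A p \<Longrightarrow> \<beta> (sharp A H p \<alpha>) = H p \<alpha> \<beta>"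
proof -
  have s: "?s \<in> fibre A p"
    by (intro subspace_sum subspace_scale sub tinv_fibre assms(2))
  have b: "\<beta> ?s = H p \<alpha> \<beta>" if "\<beta> \<in> dual_fibre A p" for \<beta>
    using linear_on_sum[OF dual_fibre_linear[OF that] sub, of E "tinv p"] tinv_fibre[OF assms(2)]
    by (simp add: Sym2_sum[OF assms that] mult.commute)
  show "sharp A H p \<alpha> = ?s"
    unfolding sharp_def
    by (rule the_equality) (use s b fibre_eqI[OF assms(2) _ s] in auto)
  with s b show "sharp A H p \<alpha> \<in> fibre A p"
    and "\<beta> \<in> dual_fibre A p \<Longrightarrow> \<beta> (sharp A H p \<alpha>) = H p \<alpha> \<beta>"
    by auto
qed

section \<open>Smoothness of tensor operations in one trivialisation\<close>

lemma local_section_tinv: "local_section A U \<Phi> (\<lambda>p. tinv p e)"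
  unfolding local_section_def
  using msmooth_on_cong[OF M open_U msmooth_on_const[OF M open_U, of e]]
  by (auto simp: tinv_fibre phi_tinv)

text \<open>Expansion in the frame. Smoothness on sections with constant coordinates, the form in
  which \<open>bundle_endo\<close>, \<open>dual_sections\<close> and \<open>Sym2_dual\<close>
  provide it, thus extends to arbitrary local sections.\<close>

lemma msmooth_on_linear_coordinates:
  assumes "local_section A U \<Phi> x" "\<And>p. p \<in> U \<Longrightarrow> linear_on (fibre A p) (h p)"
    and "\<And>e. msmooth_on A U (\<lambda>p. h p (tinv p e))"
  shows "msmooth_on A U (\<lambda>p. h p (x p) :: 'b::real_normed_vector)"
proof (rule msmooth_on_cong[OF M open_U])
  show "msmooth_on A U (\<lambda>p. \<Sum>i\<in>E. (\<Phi> p (x p) \<bullet> i) *\<^sub>R h p (tinv p i))"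
    using assms by (intro msmooth_on_sum msmooth_on_scaleR msmooth_on_inner M open_U)
      (auto simp: local_section_def)
  show "(\<Sum>i\<in>E. (\<Phi> p (x p) \<bullet> i) *\<^sub>R h p (tinv p i)) = h p (x p)" if "p \<in> U" for p
    using linear_on_expansion[OF that assms(2)[OF that], of "x p"] assms(1) that
    by (auto simp: local_section_def)
qed

lemma msmooth_on_pair:
  assumes "local_section A U \<Phi> x" "local_dual_section A U \<Phi> \<alpha>"
  shows "msmooth_on A U (\<lambda>p. \<alpha> p (x p))"
  by (rule msmooth_on_linear_coordinates[OF assms(1)])
    (use assms(2) dual_fibre_linear in \<open>auto simp: local_dual_section_def\<close>)

lemma local_dual_section_pull:
  assumes "linear \<epsilon>"
  shows "local_dual_section A U \<Phi> (\<lambda>p. pull A \<Phi> p \<epsilon>)"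
  unfolding local_dual_section_def
proof (intro conjI ballI allI)
  show "msmooth_on A U (\<lambda>p. pull A \<Phi> p \<epsilon> (tinv p e))" for e
    by (rule msmooth_on_cong[OF M open_U msmooth_on_const[OF M open_U, of "\<epsilon> e"]])
      (simp add: pull_def tinv_fibre phi_tinv)
qed (rule pull_dual[OF _ assms])

lemma flat_dual:
  assumes "B \<in> Sym2_dual A" "u \<in> fibre A p"
  shows "flat A B p u \<in> dual_fibre A p"
proof -
  have "linear_on (fibre A p) (\<lambda>v. B p v u)" "\<And>v. v \<in> fibre A p \<Longrightarrow> B p u v = B p v u"
    using assms by (auto simp: Sym2_dual_def)
  then show ?thesis
    using sub[of p] by (auto simp: flat_def dual_fibre_def linear_on_def subspace_add subspace_scale)
qed

lemma local_dual_section_flat: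
  assumes "B \<in> Sym2_dual A" "local_section A U \<Phi> x"
  shows "local_dual_section A U \<Phi> (\<lambda>p. flat A B p (x p))"
  unfolding local_dual_section_def
proof (intro conjI ballI allI)
  show "flat A B p (x p) \<in> dual_fibre A p" if "p \<in> U" for p
    using assms that by (auto simp: local_section_def intro: flat_dual)
  fix e
  have "msmooth_on A U (\<lambda>p. B p (x p) (tinv p e))"
  proof (rule msmooth_on_linear_coordinates[OF assms(2)])
    show "linear_on (fibre A p) (\<lambda>v. B p v (tinv p e))" if "p \<in> U" for p
      using assms(1) tinv_fibre[OF that] by (auto simp: Sym2_dual_def)
    show "msmooth_on A U (\<lambda>p. B p (tinv p e') (tinv p e))" for e'
      using assms(1) triv by (auto simp: Sym2_dual_def)
  qed
  then show "msmooth_on A U (\<lambda>p. flat A B p (x p) (tinv p e))"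
    by (rule msmooth_on_cong[OF M open_U]) (simp add: flat_def tinv_fibre)
qed

lemma msmooth_on_Sym2:
  assumes "H \<in> Sym2 A" "local_dual_section A U \<Phi> \<alpha>" "local_dual_section A U \<Phi> \<beta>"
  shows "msmooth_on A U (\<lambda>p. H p (\<alpha> p) (\<beta> p))"
proof (rule msmooth_on_cong[OF M open_U])
  have [simp]: "linear (\<lambda>w. w \<bullet> i)" for i :: 'f
    by (intro bounded_linear.linear bounded_linear_inner_left)
  show "msmooth_on A U (\<lambda>p. \<Sum>i\<in>E. \<beta> p (tinv p i) *
      (\<Sum>j\<in>E. \<alpha> p (tinv p j) * H p (coframe p i) (coframe p j)))"
    using assms triv
    by (intro msmooth_on_sum msmooth_on_mult M open_U) (auto simp: local_dual_section_def Sym2_def)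
  fix p assume p: "p \<in> U"
  then have ab: "\<alpha> p \<in> dual_fibre A p" "\<beta> p \<in> dual_fibre A p"
    using assms by (auto simp: local_dual_section_def)
  have "H p (coframe p i) (\<alpha> p) = H p (\<alpha> p) (coframe p i)" for i
    using assms(1) ab coframe_dual[OF p] by (auto simp: Sym2_def)
  then show "(\<Sum>i\<in>E. \<beta> p (tinv p i) *
      (\<Sum>j\<in>E. \<alpha> p (tinv p j) * H p (coframe p i) (coframe p j))) = H p (\<alpha> p) (\<beta> p)"
    using Sym2_sum[OF assms(1) p _ ab(1)] Sym2_sum[OF assms(1) p ab] coframe_dual[OF p] by simp
qed

lemma local_section_sharp:
  assumes "H \<in> Sym2 A" "local_dual_section A U \<Phi> \<alpha>"
  shows "local_section A U \<Phi> (\<lambda>p. sharp A H p (\<alpha> p))"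
proof -
  have a: "\<alpha> p \<in> dual_fibre A p" if "p \<in> U" for p
    using assms that by (auto simp: local_dual_section_def)
  have "msmooth_on A U (\<lambda>p. \<Sum>i\<in>E. H p (\<alpha> p) (coframe p i) *\<^sub>R i)"
    by (intro msmooth_on_sum msmooth_on_scaleR msmooth_on_const M open_U
        msmooth_on_Sym2[OF assms] local_dual_section_pull bounded_linear.linear
        bounded_linear_inner_left)
  then have "msmooth_on A U (\<lambda>p. \<Phi> p (sharp A H p (\<alpha> p)))"
  proof (rule msmooth_on_cong[OF M open_U])
    fix p assume p: "p \<in> U"
    show "(\<Sum>i\<in>E. H p (\<alpha> p) (coframe p i) *\<^sub>R i) = \<Phi> p (sharp A H p (\<alpha> p))"
      unfolding sharp_formula(1)[OF assms(1) p a[OF p]]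
      using linear_on_sum[OF phi_linear[OF p] sub, of E "tinv p"] tinv_fibre[OF p]
      by (simp add: phi_tinv[OF p])
  qed
  then show ?thesis
    using sharp_formula(2)[OF assms(1) _ a] by (auto simp: local_section_def)
qed

lemma local_section_endo:
  assumes "bundle_endo A N" "local_section A U \<Phi> x"
  shows "local_section A U \<Phi> (\<lambda>p. N p (x p))"
proof -
  have N: "N p u \<in> fibre A p" "linear_on (fibre A p) (N p)" if "u \<in> fibre A p" for p u
    using assms(1) that by (auto simp: bundle_endo_def)
  have "msmooth_on A U (\<lambda>p. \<Phi> p (N p (x p)))"
  proof (rule msmooth_on_linear_coordinates[OF assms(2)])
    show "linear_on (fibre A p) (\<lambda>u. \<Phi> p (N p u))" if "p \<in> U" for p
      using phi_linear[OF that] N(1) N(2)[OF subspace_0[OF sub]] by (simp add: linear_on_def)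
    show "msmooth_on A U (\<lambda>p. \<Phi> p (N p (tinv p e)))" for e
      using assms(1) triv by (auto simp: bundle_endo_def)
  qed
  then show ?thesis
    using N(1) assms(2) by (auto simp: local_section_def)
qed

lemma local_section_flat_inv:
  assumes "B \<in> Sym2_dual A" "nondegenerate A B" "local_dual_section A U \<Phi> \<alpha>"
  shows "local_section A U \<Phi> (\<lambda>p. flat_inv A B p (\<alpha> p))"
proof -
  define y where "y p = flat_inv A B p (\<alpha> p)" for p
  have bij: "bij_betw (flat A B p) (fibre A p) (dual_fibre A p)" for p
    using assms(2) by (auto simp: nondegenerate_def)
  have a: "\<alpha> p \<in> dual_fibre A p" if "p \<in> U" for p
    using assms that by (auto simp: local_dual_section_def)
  have y: "y p \<in> fibre A p" "flat A B p (y p) = \<alpha> p" if "p \<in> U" for p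
    using a[OF that] bij[of p]
    by (auto simp: y_def flat_inv_def bij_betw_def inv_into_into f_inv_into_f)
  have lin: "linear_on (fibre A p) (\<lambda>v. B p v u)" if "u \<in> fibre A p" for p u
    using assms(1) that by (auto simp: Sym2_dual_def)
  \<comment> \<open>Evaluating \<open>flat A B p (y p) = \<alpha> p\<close> on the frame gives a
    linear system for the coordinates of \<open>y p\<close>, whose coefficients are the Gram matrix
    of \<open>B\<close>.\<close>
  have coord: "msmooth_on A U (\<lambda>p. \<Phi> p (y p) \<bullet> i)" if "i \<in> E" for i
  proof (rule msmooth_on_linear_system[OF M frame(1) open_U, where J = E
        and m = "\<lambda>i j p. B p (tinv p i) (tinv p j)" and a = "\<lambda>j p. \<alpha> p (tinv p j)"
        and y = "\<lambda>i p. \<Phi> p (y p) \<bullet> i"])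
    show "msmooth_on A U (\<lambda>p. B p (tinv p i) (tinv p j))" for i j
      using assms(1) triv by (auto simp: Sym2_dual_def)
    show "msmooth_on A U (\<lambda>p. \<alpha> p (tinv p j))" for j
      using assms(3) by (auto simp: local_dual_section_def)
    show "(\<Sum>i\<in>E. (\<Phi> p (y p) \<bullet> i) * B p (tinv p i) (tinv p j)) = \<alpha> p (tinv p j)"
      if "p \<in> U" for p j
      using linear_on_expansion[OF that lin[OF tinv_fibre[OF that]] y(1)[OF that]]
        arg_cong[OF y(2)[OF that], of "\<lambda>f. f (tinv p j)"] tinv_fibre[OF that]
      by (simp add: flat_def)
    fix p :: 'm and c :: "'f \<Rightarrow> real" and i :: 'f
    assume p: "p \<in> U" and i: "i \<in> E"
      and c: "\<And>j. j \<in> E \<Longrightarrow> (\<Sum>i\<in>E. c i * B p (tinv p i) (tinv p j)) = 0"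
    \<comment> \<open>Coefficients in the kernel of the Gram matrix form a vector that
      \<open>flat\<close> sends to zero; injectivity of \<open>flat\<close> on the fibre makes it
      zero.\<close>
    let ?u = "\<Sum>i\<in>E. c i *\<^sub>R tinv p i"
    have u: "?u \<in> fibre A p"
      by (intro subspace_sum subspace_scale sub tinv_fibre p)
    have Bu: "B p ?u v = (\<Sum>i\<in>E. c i * B p (tinv p i) v)" if "v \<in> fibre A p" for v
      using linear_on_sum[OF lin[OF that] sub, of E "tinv p" c] tinv_fibre[OF p] by simp
    have "flat A B p ?u (tinv p j) = 0" if "j \<in> E" for j
      using Bu[OF tinv_fibre[OF p]] c[OF that] tinv_fibre[OF p] by (simp add: flat_def)
    then have "flat A B p ?u = (\<lambda>v. 0)"
      using dual_expansion[OF p flat_dual[OF assms(1) u]] by simp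
    moreover have "flat A B p 0 = (\<lambda>v. 0)"
    proof
      fix v
      show "flat A B p 0 v = 0"
        using linear_on_sum[OF lin[of v p] sub, of "{}"] by (simp add: flat_def)
    qed
    ultimately have "?u = 0"
      using bij[of p] u subspace_0[OF sub] by (auto simp: bij_betw_def inj_on_def)
    moreover have "\<Phi> p ?u = (\<Sum>i\<in>E. c i *\<^sub>R i)"
      using linear_on_sum[OF phi_linear[OF p] sub, of E "tinv p"] tinv_fibre[OF p]
      by (simp add: phi_tinv[OF p])
    moreover have "\<Phi> p 0 = 0"
      using linear_on_sum[OF phi_linear[OF p] sub, of "{}"] by simp
    ultimately have "0 = (\<Sum>k\<in>E. c k *\<^sub>R k) \<bullet> i"
      by simp
    also have "\<dots> = (\<Sum>k\<in>E. if k = i then c k else 0)"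
      unfolding inner_sum_left by (rule sum.cong) (use frame(2) i in auto)
    finally show "c i = 0"
      using i frame(1) by simp
  qed (rule that)
  have "msmooth_on A U (\<lambda>p. \<Sum>i\<in>E. (\<Phi> p (y p) \<bullet> i) *\<^sub>R i)"
    by (intro msmooth_on_sum msmooth_on_scaleR msmooth_on_const M open_U coord)
  then show ?thesis
    using y(1) by (simp add: frame local_section_def y_def)
qed

end

section \<open>Sections through a given vector\<close>

lemma msmooth_on_add:
  assumes "smooth_manifold M" "open U" "msmooth_on M U f" "msmooth_on M U g"
  shows "msmooth_on M U (\<lambda>p. f p + g p)"
  unfolding msmooth_on_def
proof clarify
  fix V \<phi> assume V: "(V, \<phi>) \<in> charts M"
  show "smooth_on (\<phi> ` (U \<inter> V)) (\<lambda>x. f (inv_into V \<phi> x) + g (inv_into V \<phi> x))"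
    by (rule smooth_on_add)
      (use assms(3,4) V chart_open_image[OF assms(1) V assms(2)] in \<open>auto simp: msmooth_on_def\<close>)
qed

lemma msmooth_on_flat_exp:
  assumes "smooth_manifold M" "open U" "msmooth_on M U f"
  shows "msmooth_on M U (\<lambda>p. flat_exp n (f p))"
  unfolding msmooth_on_def
proof clarify
  fix V \<phi> assume V: "(V, \<phi>) \<in> charts M"
  show "smooth_on (\<phi> ` (U \<inter> V)) (\<lambda>x. flat_exp n (f (inv_into V \<phi> x)))"
    by (rule smooth_on_flat_exp)
      (use assms(3) V chart_open_image[OF assms(1) V assms(2)] in \<open>auto simp: msmooth_on_def\<close>)
qed

lemma msmooth_on_chart:
  assumes "smooth_manifold M" "(V, \<phi>) \<in> charts M"
  shows "msmooth_on M V \<phi>"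
  unfolding msmooth_on_def
proof clarify
  fix W \<psi> assume "(W, \<psi>) \<in> charts M"
  moreover have "\<forall>(W, \<psi>)\<in>charts M. \<forall>(V, \<phi>)\<in>charts M.
      smooth_on (\<psi> ` (W \<inter> V)) (\<lambda>x. \<phi> (inv_into W \<psi> x))"
    using assms(1) by (simp add: smooth_manifold_def)
  ultimately have "smooth_on (\<psi> ` (W \<inter> V)) (\<lambda>x. \<phi> (inv_into W \<psi> x))"
    using assms(2) by blast
  then show "smooth_on (\<psi> ` (V \<inter> W)) (\<lambda>x. \<phi> (inv_into W \<psi> x))"
    by (simp add: Int_commute)
qed

text \<open>The closed set \<open>K\<close> is recorded because its complement is open: extension by
  zero is glued from an open set containing \<open>K\<close> and \<open>- K\<close>. As the image of
  a compact coordinate ball, \<open>K\<close> is closed in the Hausdorff space \<open>'m\<close>;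
  compactness of the ball is where finite dimension enters.\<close>

lemma bump_function:
  fixes M :: "('m::{t2_space,second_countable_topology}, 'e::real_inner, 'z) manifold_scheme"
  assumes M: "smooth_manifold M" and W: "open W" "p \<in> W"
  obtains f :: "'m \<Rightarrow> real" and K
  where "msmooth_on M UNIV f" "f p \<noteq> 0" "closed K" "K \<subseteq> W" "{q. f q \<noteq> 0} \<subseteq> K"
proof -
  have "p \<in> (\<Union>(V, \<phi>)\<in>charts M. V)"
    using M by (simp add: smooth_manifold_def)
  then obtain V \<phi> where V: "(V, \<phi>) \<in> charts M" "p \<in> V"
    by auto
  have "open (\<phi> ` (W \<inter> V))" "\<phi> p \<in> \<phi> ` (W \<inter> V)"
    using chart_open_image[OF M V(1) W(1)] W V by auto
  then obtain r where r: "r > 0" "cball (\<phi> p) r \<subseteq> \<phi> ` (W \<inter> V)"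
    using open_contains_cball by metis
  have sub: "cball (\<phi> p) r \<subseteq> \<phi> ` V"
    using r(2) by blast
  define K where "K = inv_into V \<phi> ` cball (\<phi> p) r"
  have "finite_dimensional TYPE('e)"
    using M by (simp add: smooth_manifold_def)
  then have "compact (cball (\<phi> p) r)"
    by (rule compact_cball_finite_dimensional)
  moreover have "continuous_on (cball (\<phi> p) r) (inv_into V \<phi>)"
    using chart_homeomorphism[OF M V(1)] continuous_on_subset[OF _ sub]
    by (auto simp: homeomorphism_def)
  ultimately have "closed K"
    unfolding K_def by (intro compact_imp_closed compact_continuous_image)
  have KW: "K \<subseteq> W \<inter> V"
  proof
    fix q assume "q \<in> K"
    then obtain x where x: "x \<in> cball (\<phi> p) r" "q = inv_into V \<phi> x"
      by (auto simp: K_def)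
    then obtain q' where "q' \<in> W \<inter> V" "x = \<phi> q'"
      using r(2) by blast
    then show "q \<in> W \<inter> V"
      using chart_inverse[OF M V(1)] x(2) by auto
  qed
  \<comment> \<open>The argument of \<open>flat_exp\<close> is positive exactly inside the
    coordinate ball. The squared norm as an inner product is smooth at the centre too, and
    \<open>+ -\<close> fits the closure rules.\<close>
  define f where
    "f q = (if q \<in> V then flat_exp 0 (r\<^sup>2 + - ((\<phi> q + - \<phi> p) \<bullet> (\<phi> q + - \<phi> p))) else 0)" for q
  have f0: "f q = 0" if "q \<notin> K" for q
  proof (cases "q \<in> V")
    case True
    then have "\<phi> q \<notin> cball (\<phi> p) r"
      using that chart_inverse[OF M V(1) True] unfolding K_def by (metis imageI)
    then have "r < norm (\<phi> q - \<phi> p)"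
      by (simp add: dist_norm norm_minus_commute)
    then have "r\<^sup>2 < (norm (\<phi> q - \<phi> p))\<^sup>2"
      using r(1) by (intro power_strict_mono) auto
    then show ?thesis
      by (simp add: f_def flat_exp_def dot_square_norm)
  qed (simp add: f_def)
  have "open V" "open (- K)"
    using chart_open[OF M V(1)] \<open>closed K\<close> by auto
  have "msmooth_on M V f"
  proof (rule msmooth_on_cong[OF M \<open>open V\<close>])
    show "msmooth_on M V (\<lambda>q. flat_exp 0 (r\<^sup>2 + - ((\<phi> q + - \<phi> p) \<bullet> (\<phi> q + - \<phi> p))))"
      by (intro msmooth_on_flat_exp msmooth_on_add msmooth_on_const M \<open>open V\<close>
          msmooth_on_bounded_linear[OF M _ bounded_linear_minus[OF bounded_linear_ident]]
          msmooth_on_bounded_bilinear[OF M _ bounded_bilinear_inner] msmooth_on_chart[OF M V(1)])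
  qed (simp add: f_def)
  moreover have "msmooth_on M (- K) f"
    by (rule msmooth_on_cong[OF M \<open>open (- K)\<close> msmooth_on_const[OF M \<open>open (- K)\<close>, of 0]])
      (simp add: f0)
  ultimately have "msmooth_on M (V \<union> - K) f"
    by (rule msmooth_on_Un[OF M \<open>open V\<close> \<open>open (- K)\<close>])
  moreover have "V \<union> - K = UNIV"
    using KW by blast
  moreover have "f p \<noteq> 0"
    using V r(1) by (simp add: f_def flat_exp_def)
  ultimately show ?thesis
    using that[of f K] \<open>closed K\<close> KW f0 by auto
qed

lemma section_through:
  fixes A :: "('m::{t2_space,second_countable_topology}, 'e::real_inner, 'v::real_vector,
      'f::real_inner, 'z) vbundle_scheme"
  assumes vb: "vector_bundle A" and u: "u \<in> fibre A p"
  obtains x where "x \<in> sections A" "x p = u"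
proof -
  obtain U \<Phi> where U: "(U, \<Phi>) \<in> trivs A" "p \<in> U"
    using vector_bundle_cover[OF vb] .
  interpret trivialised_bundle A U \<Phi>
    by unfold_locales (use vb U in auto)
  obtain f :: "'m \<Rightarrow> real" and K where f: "msmooth_on A UNIV f" "f p \<noteq> 0" "closed K" "K \<subseteq> U" "{q. f q \<noteq> 0} \<subseteq> K"
    using bump_function[OF M open_U U(2)] .
  \<comment> \<open>The value \<open>f p\<close> is only known to be nonzero, hence the normalising
    factor.\<close>
  define x where "x q = (if q \<in> U then (inverse (f p) * f q) *\<^sub>R tinv q (\<Phi> p u) else 0)" for q
  have x: "x q \<in> fibre A q" for q
    using tinv_fibre sub by (auto simp: x_def subspace_scale subspace_0)
  have "local_section A U' \<Phi>' x" if U': "(U', \<Phi>') \<in> trivs A" for U' \<Phi>'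
  proof -
    interpret V: trivialised_bundle A U' \<Phi>'
      by unfold_locales (use vb U' in auto)
    \<comment> \<open>In another trivialisation \<open>x\<close> is a scalar function times a
      transition map on the overlap, and zero off \<open>K\<close>. The two open sets cover
      \<open>U'\<close> because \<open>K\<close> lies in \<open>U\<close>.\<close>
    have op: "open (U' \<inter> U)" "open (U' \<inter> - K)"
      using V.open_U open_U f(3) by auto
    have "\<forall>(U, \<Phi>)\<in>trivs A. \<forall>(W, \<Psi>)\<in>trivs A. \<forall>e.
        msmooth_on A (U \<inter> W) (\<lambda>p. \<Psi> p (triv_inv A \<Phi> p e))"
      using vb by (simp add: vector_bundle_def)
    then have "msmooth_on A (U \<inter> U') (\<lambda>q. \<Phi>' q (tinv q (\<Phi> p u)))"
      using U(1) U' by blast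
    then have T: "msmooth_on A (U' \<inter> U) (\<lambda>q. \<Phi>' q (tinv q (\<Phi> p u)))"
      by (simp add: Int_commute)
    have "msmooth_on A (U' \<inter> U) (\<lambda>q. (inverse (f p) * f q) *\<^sub>R \<Phi>' q (tinv q (\<Phi> p u)))"
      by (intro msmooth_on_scaleR msmooth_on_mult msmooth_on_const M op T
          msmooth_on_subset[OF M f(1)]) simp
    then have "msmooth_on A (U' \<inter> U) (\<lambda>q. \<Phi>' q (x q))"
      by (rule msmooth_on_cong[OF M op(1)])
        (use V.phi_linear tinv_fibre in \<open>simp add: x_def linear_on_def\<close>)
    moreover have "msmooth_on A (U' \<inter> - K) (\<lambda>q. \<Phi>' q (x q))"
    proof (rule msmooth_on_cong[OF M op(2) msmooth_on_const[OF M op(2), of 0]])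
      fix q assume q: "q \<in> U' \<inter> - K"
      then have "x q = 0"
        using f(5) by (auto simp: x_def)
      then show "0 = \<Phi>' q (x q)"
        using linear_on_sum[OF V.phi_linear sub, of q "{}"] q by simp
    qed
    ultimately have "msmooth_on A ((U' \<inter> U) \<union> (U' \<inter> - K)) (\<lambda>q. \<Phi>' q (x q))"
      by (rule msmooth_on_Un[OF M op])
    moreover have "(U' \<inter> U) \<union> (U' \<inter> - K) = U'"
      using f(4) by blast
    ultimately show ?thesis
      using x by (simp add: local_section_def)
  qed
  then have "x \<in> sections A"
    using sections_iff_local[OF vb] by auto
  moreover have "x p = u"
    using U(2) f(2) u by (simp add: x_def tinv_phi)
  ultimately show ?thesis
    using that by blast
qed

section \<open>Tensors on a vector bundle\<close>

lemma trivialised_bundle_cover: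
  assumes "vector_bundle A"
  obtains U \<Phi> where "trivialised_bundle A U \<Phi>" "p \<in> U"
proof -
  obtain U \<Phi> where "(U, \<Phi>) \<in> trivs A" "p \<in> U"
    using vector_bundle_cover[OF assms] .
  then show ?thesis
    by (intro that[of U \<Phi>] trivialised_bundle.intro assms)
qed

context
  fixes A :: "('m::{t2_space,second_countable_topology}, 'e::real_inner, 'v::real_vector,
      'f::real_inner, 'z) vbundle_scheme"
  assumes vb: "vector_bundle A"
begin

lemma subspace_fibre: "subspace (fibre A p)"
  using vb by (simp add: vector_bundle_def)

lemma section_fibre: "x \<in> sections A \<Longrightarrow> x p \<in> fibre A p"
  by (simp add: sections_def)

lemma Sym2_dual_linear:
  assumes "B \<in> Sym2_dual A" "u \<in> fibre A p"
  shows "linear_on (fibre A p) (\<lambda>v. B p v u)" "linear_on (fibre A p) (B p u)"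
proof -
  show l: "linear_on (fibre A p) (\<lambda>v. B p v u)"
    using assms by (auto simp: Sym2_dual_def)
  have "B p u v = B p v u" if "v \<in> fibre A p" for v
    using assms that by (auto simp: Sym2_dual_def)
  with l show "linear_on (fibre A p) (B p u)"
    using subspace_fibre[of p] by (simp add: linear_on_def subspace_add subspace_scale)
qed

lemma Sym2_dual_sym:
  "B \<in> Sym2_dual A \<Longrightarrow> u \<in> fibre A p \<Longrightarrow> v \<in> fibre A p \<Longrightarrow> B p u v = B p v u"
  by (auto simp: Sym2_dual_def)

lemma flat_in_dual_fibre:
  assumes "B \<in> Sym2_dual A" "u \<in> fibre A p"
  shows "flat A B p u \<in> dual_fibre A p"
proof -
  obtain U \<Phi> where "trivialised_bundle A U \<Phi>" "p \<in> U"
    using trivialised_bundle_cover[OF vb] .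
  then show ?thesis
    using trivialised_bundle.flat_dual[OF _ assms] by blast
qed

lemma flat_in_dual_sections:
  assumes "B \<in> Sym2_dual A" "x \<in> sections A"
  shows "(\<lambda>p. flat A B p (x p)) \<in> dual_sections A"
  using assms(2) trivialised_bundle.local_dual_section_flat[OF trivialised_bundle.intro[OF vb] assms(1)]
  by (auto simp: dual_sections_iff_local[OF vb] sections_iff_local[OF vb])

lemma flat_inv_in_sections:
  assumes "B \<in> Sym2_dual A" "nondegenerate A B" "\<alpha> \<in> dual_sections A"
  shows "(\<lambda>p. flat_inv A B p (\<alpha> p)) \<in> sections A"
  using assms(3) trivialised_bundle.local_section_flat_inv[OF trivialised_bundle.intro[OF vb] assms(1,2)]
  by (auto simp: dual_sections_iff_local[OF vb] sections_iff_local[OF vb])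

lemma endo_in_sections:
  assumes "bundle_endo A N" "x \<in> sections A"
  shows "app N x \<in> sections A"
  using assms(2) trivialised_bundle.local_section_endo[OF trivialised_bundle.intro[OF vb] assms(1)]
  by (auto simp: sections_iff_local[OF vb] app_def)

lemma flat_inv_fibre:
  assumes "nondegenerate A B" "\<alpha> \<in> dual_fibre A p"
  shows "flat_inv A B p \<alpha> \<in> fibre A p" "flat A B p (flat_inv A B p \<alpha>) = \<alpha>"
  using assms by (auto simp: flat_inv_def nondegenerate_def bij_betw_def inv_into_into f_inv_into_f)

lemma flat_inv_flat:
  "nondegenerate A B \<Longrightarrow> u \<in> fibre A p \<Longrightarrow> flat_inv A B p (flat A B p u) = u"
  by (simp add: flat_inv_def nondegenerate_def bij_betw_def)

lemma nondegenerate_eq_0: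
  assumes "B \<in> Sym2_dual A" "nondegenerate A B" "u \<in> fibre A p" "\<And>v. v \<in> fibre A p \<Longrightarrow> B p v u = 0"
  shows "u = 0"
proof -
  have 0: "0 \<in> fibre A p"
    using subspace_fibre by (rule subspace_0)
  have "flat A B p u = flat A B p 0"
  proof
    fix v
    show "flat A B p u v = flat A B p 0 v"
      using assms(4)[of v] Sym2_dual_sym[OF assms(1,3)]
        linear_on_sum[OF Sym2_dual_linear(1)[OF assms(1), of v p] subspace_fibre, of "{}"]
      by (simp add: flat_def)
  qed
  then show ?thesis
    using flat_inv_flat[OF assms(2,3)] flat_inv_flat[OF assms(2) 0] by simp
qed

lemma sharp_fibre:
  assumes "H \<in> Sym2 A" "\<alpha> \<in> dual_fibre A p"
  shows "sharp A H p \<alpha> \<in> fibre A p"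
    and "\<beta> \<in> dual_fibre A p \<Longrightarrow> \<beta> (sharp A H p \<alpha>) = H p \<alpha> \<beta>"
proof -
  obtain U \<Phi> where "trivialised_bundle A U \<Phi>" "p \<in> U"
    using trivialised_bundle_cover[OF vb] .
  note * = trivialised_bundle.sharp_formula[OF this(1) assms(1) this(2) assms(2)]
  show "sharp A H p \<alpha> \<in> fibre A p"
    and "\<beta> \<in> dual_fibre A p \<Longrightarrow> \<beta> (sharp A H p \<alpha>) = H p \<alpha> \<beta>"
    by (rule *(2), rule *(3))
qed

lemma fibre_eq_iff_dual:
  assumes "u \<in> fibre A p" "v \<in> fibre A p" "\<And>\<beta>. \<beta> \<in> dual_fibre A p \<Longrightarrow> \<beta> u = \<beta> v"
  shows "u = v"
proof -
  obtain U \<Phi> where "trivialised_bundle A U \<Phi>" "p \<in> U"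
    using trivialised_bundle_cover[OF vb] .
  then show ?thesis
    by (rule trivialised_bundle.fibre_eqI) (rule assms)+
qed

text \<open>Linearity is checked after pairing with every covector, since \<open>sharp\<close> is
  accessible only through its values there.\<close>

lemma bundle_endo_sharp_flat:
  assumes H: "H \<in> Sym2 A" and B: "B \<in> Sym2_dual A"
  shows "bundle_endo A (sharp_flat A H B)"
  unfolding bundle_endo_def
proof (intro conjI allI)
  fix p
  note fl = flat_in_dual_fibre[OF B]
  have S: "sharp_flat A H B p u \<in> fibre A p"
    "\<beta> \<in> dual_fibre A p \<Longrightarrow> \<beta> (sharp_flat A H B p u) = H p (flat A B p u) \<beta>"
    if "u \<in> fibre A p" for u \<beta>
    unfolding sharp_flat_def using sharp_fibre[OF H fl[OF that]] by blast+
  then show "sharp_flat A H B p ` fibre A p \<subseteq> fibre A p"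
    by blast
  have lin: "linear_on (fibre A p) (\<lambda>u. B p u v)" if "v \<in> fibre A p" for v
    using Sym2_dual_linear(1)[OF B that] .
  have Hadd: "H p (\<lambda>u. \<alpha> u + \<beta> u) \<gamma> = H p \<alpha> \<gamma> + H p \<beta> \<gamma>"
    and Hscale: "H p (\<lambda>u. c * \<alpha> u) \<beta> = c * H p \<alpha> \<beta>"
    if "\<alpha> \<in> dual_fibre A p" "\<beta> \<in> dual_fibre A p" "\<gamma> \<in> dual_fibre A p" for \<alpha> \<beta> \<gamma> c
    using H that by (auto simp: Sym2_def)
  have flat_add: "flat A B p (u + v) = (\<lambda>w. flat A B p u w + flat A B p v w)"
    and flat_scale: "flat A B p (c *\<^sub>R u) = (\<lambda>w. c * flat A B p u w)"
    if "u \<in> fibre A p" "v \<in> fibre A p" for u v c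
    using lin that by (auto simp: flat_def linear_on_def)
  note mem = subspace_add[OF subspace_fibre] subspace_scale[OF subspace_fibre]
  show "linear_on (fibre A p) (sharp_flat A H B p)"
    unfolding linear_on_def
  proof (intro conjI ballI allI)
    fix u v assume uv: "u \<in> fibre A p" "v \<in> fibre A p"
    show "sharp_flat A H B p (u + v) = sharp_flat A H B p u + sharp_flat A H B p v"
    proof (rule fibre_eq_iff_dual)
      fix \<beta> assume b: "\<beta> \<in> dual_fibre A p"
      have "\<beta> (sharp_flat A H B p u + sharp_flat A H B p v) =
          \<beta> (sharp_flat A H B p u) + \<beta> (sharp_flat A H B p v)"
        using b S(1)[OF uv(1)] S(1)[OF uv(2)] by (simp add: dual_fibre_def linear_on_def)
      then show "\<beta> (sharp_flat A H B p (u + v)) = \<beta> (sharp_flat A H B p u + sharp_flat A H B p v)"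
        using S(2)[OF uv(1) b] S(2)[OF uv(2) b] S(2)[OF mem(1)[OF uv] b]
          Hadd[OF fl[OF uv(1)] fl[OF uv(2)] b] flat_add[OF uv]
        by simp
    qed (use S(1) mem uv in auto)
  next
    fix c u assume u: "u \<in> fibre A p"
    show "sharp_flat A H B p (c *\<^sub>R u) = c *\<^sub>R sharp_flat A H B p u"
    proof (rule fibre_eq_iff_dual)
      fix \<beta> assume b: "\<beta> \<in> dual_fibre A p"
      have "\<beta> (c *\<^sub>R sharp_flat A H B p u) = c * \<beta> (sharp_flat A H B p u)"
        using b S(1)[OF u] by (simp add: dual_fibre_def linear_on_def)
      then show "\<beta> (sharp_flat A H B p (c *\<^sub>R u)) = \<beta> (c *\<^sub>R sharp_flat A H B p u)"
        using S(2)[OF u b] S(2)[OF mem(2)[OF u] b] Hscale[OF fl[OF u] b b] flat_scale[OF u u]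
        by simp
    qed (use S(1) mem u in auto)
  qed
next
  have "msmooth_on A U (\<lambda>p. \<Phi> p (sharp_flat A H B p (triv_inv A \<Phi> p e)))"
    if "(U, \<Phi>) \<in> trivs A" for U \<Phi> e
  proof -
    interpret trivialised_bundle A U \<Phi>
      by unfold_locales (use vb that in auto)
    have "local_section A U \<Phi> (\<lambda>p. sharp A H p (flat A B p (tinv p e)))"
      by (intro local_section_sharp[OF H] local_dual_section_flat[OF B] local_section_tinv)
    then show ?thesis
      by (simp add: local_section_def sharp_flat_def)
  qed
  then show "\<forall>(U, \<Phi>)\<in>trivs A. \<forall>e. msmooth_on A U (\<lambda>p. \<Phi> p (sharp_flat A H B p (triv_inv A \<Phi> p e)))"
    by blast
qed

text \<open>Both sides equal \<open>H\<close> on the covectors of \<open>u\<close> and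
  \<open>v\<close>, so this is the symmetry of \<open>H\<close>.\<close>

lemma sharp_flat_symmetric:
  assumes H: "H \<in> Sym2 A" and B: "B \<in> Sym2_dual A" and uv: "u \<in> fibre A p" "v \<in> fibre A p"
  shows "B p (sharp_flat A H B p u) v = B p u (sharp_flat A H B p v)"
proof -
  have *: "B p v (sharp_flat A H B p u) = H p (flat A B p u) (flat A B p v)"
    "sharp_flat A H B p u \<in> fibre A p"
    if "u \<in> fibre A p" "v \<in> fibre A p" for u v
    using sharp_fibre[OF H flat_in_dual_fibre[OF B that(1)]] flat_in_dual_fibre[OF B that(2)]
    by (auto simp: sharp_flat_def flat_def)
  have "H p (flat A B p u) (flat A B p v) = H p (flat A B p v) (flat A B p u)"
    using H flat_in_dual_fibre[OF B] uv by (auto simp: Sym2_def)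
  then show ?thesis
    using * uv Sym2_dual_sym[OF B *(2)[OF uv] uv(2)] by simp
qed

section \<open>From a symmetric endomorphism back to a symmetric tensor\<close>

context
  fixes B N
  assumes B: "B \<in> Sym2_dual A" and nd: "nondegenerate A B" and N: "bundle_endo A N"
    and sym: "\<And>p u v. u \<in> fibre A p \<Longrightarrow> v \<in> fibre A p \<Longrightarrow> B p (N p u) v = B p u (N p v)"
begin

private abbreviation (input) H where "H \<equiv> tensor_of_sharp (\<lambda>p \<alpha>. N p (flat_inv A B p \<alpha>))"

lemma endo_fibre: "u \<in> fibre A p \<Longrightarrow> N p u \<in> fibre A p"
  using N by (auto simp: bundle_endo_def)

text \<open>If \<alpha> and \<beta> are the covectors of a and b under \<open>flat\<close>, the
  tensor takes the value B(b,Na), which is symmetric in a and b.\<close>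

lemma tensor_of_sharp_in_Sym2: "H \<in> Sym2 A"
proof -
  have s: "H p \<alpha> \<beta> = H p \<beta> \<alpha>" if "\<alpha> \<in> dual_fibre A p" "\<beta> \<in> dual_fibre A p" for p \<alpha> \<beta>
  proof -
    define a b where "a = flat_inv A B p \<alpha>" and "b = flat_inv A B p \<beta>"
    have a: "a \<in> fibre A p" "flat A B p a = \<alpha>" and b: "b \<in> fibre A p" "flat A B p b = \<beta>"
      using flat_inv_fibre[OF nd that(1)] flat_inv_fibre[OF nd that(2)] by (auto simp: a_def b_def)
    have "\<beta> (N p a) = B p b (N p a)" "\<alpha> (N p b) = B p a (N p b)"
      using a b endo_fibre by (auto simp: flat_def)
    then show ?thesis
      using sym[OF a(1) b(1)] Sym2_dual_sym[OF B endo_fibre[OF a(1)] b(1)]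
      by (simp add: tensor_of_sharp_def a_def b_def)
  qed
  have "msmooth_on A U (\<lambda>p. H p (pull A \<Phi> p \<epsilon>) (pull A \<Phi> p \<eta>))"
    if "(U, \<Phi>) \<in> trivs A" "linear \<epsilon>" "linear \<eta>" for U \<Phi> \<epsilon> \<eta>
  proof -
    interpret trivialised_bundle A U \<Phi>
      by unfold_locales (use vb that in auto)
    show ?thesis
      unfolding tensor_of_sharp_def
      by (intro msmooth_on_pair local_section_endo[OF N] local_section_flat_inv[OF B nd]
          local_dual_section_pull that)
  qed
  moreover have "(\<lambda>u. \<alpha> u + \<beta> u) \<in> dual_fibre A p" "(\<lambda>u. c * \<alpha> u) \<in> dual_fibre A p"
    if "\<alpha> \<in> dual_fibre A p" "\<beta> \<in> dual_fibre A p" for p \<alpha> \<beta> c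
    using that by (auto simp: dual_fibre_def linear_on_def algebra_simps)
  \<comment> \<open>The second slot merely evaluates its covector at a vector, so linearity there is
    immediate. Symmetry carries it to the first slot without an appeal to linearity of
    \<open>flat_inv\<close>.\<close>
  then have "H p (\<lambda>u. \<alpha> u + \<beta> u) \<gamma> = H p \<alpha> \<gamma> + H p \<beta> \<gamma>" "H p (\<lambda>u. c * \<alpha> u) \<gamma> = c * H p \<alpha> \<gamma>"
    if "\<alpha> \<in> dual_fibre A p" "\<beta> \<in> dual_fibre A p" "\<gamma> \<in> dual_fibre A p" for p \<alpha> \<beta> \<gamma> c
    using s[OF _ that(3)] that(1,2) by (simp_all add: tensor_of_sharp_def)
  ultimately show ?thesis
    using s unfolding Sym2_def by blast
qed

text \<open>Confirms that the tensor really has the prescribed sharp map; the theorem asserts this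
  equation alongside the structure.\<close>

lemma sharp_tensor_of_sharp:
  assumes "\<alpha> \<in> dual_fibre A p"
  shows "sharp A H p \<alpha> = N p (flat_inv A B p \<alpha>)"
  by (rule fibre_eq_iff_dual)
    (use sharp_fibre[OF tensor_of_sharp_in_Sym2 assms] endo_fibre flat_inv_fibre[OF nd assms]
      in \<open>auto simp: tensor_of_sharp_def\<close>)

lemma sharp_flat_tensor_of_sharp:
  "u \<in> fibre A p \<Longrightarrow> sharp_flat A H B p u = N p u"
  unfolding sharp_flat_def
  by (simp add: sharp_tensor_of_sharp flat_in_dual_fibre[OF B] flat_inv_flat[OF nd])

end

text \<open>Moving \<open>N\<close> to the other slot reduces linearity and symmetry to those of
  \<open>B\<close>.\<close>

lemma twist_in_Sym2_dual:
  assumes B: "B \<in> Sym2_dual A" and N: "bundle_endo A N"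
    and sym: "\<And>p u v. u \<in> fibre A p \<Longrightarrow> v \<in> fibre A p \<Longrightarrow> B p (N p u) v = B p u (N p v)"
  shows "twist B N \<in> Sym2_dual A"
proof -
  have Nf: "N p u \<in> fibre A p" if "u \<in> fibre A p" for p u
    using N that by (auto simp: bundle_endo_def)
  have "linear_on (fibre A p) (\<lambda>v. twist B N p v u)" if "u \<in> fibre A p" for p u
    using Sym2_dual_linear(1)[OF B Nf[OF that]] sym[OF _ that] subspace_fibre[of p]
    by (simp add: twist_def linear_on_def subspace_add subspace_scale)
  moreover have "twist B N p u v = twist B N p v u" if "u \<in> fibre A p" "v \<in> fibre A p" for p u v
    using sym[OF that] Sym2_dual_sym[OF B that(1) Nf[OF that(2)]] by (simp add: twist_def)
  moreover have "msmooth_on A U (\<lambda>p. twist B N p (triv_inv A \<Phi> p e) (triv_inv A \<Phi> p e'))"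
    if "(U, \<Phi>) \<in> trivs A" for U \<Phi> e e'
  proof -
    interpret trivialised_bundle A U \<Phi>
      by unfold_locales (use vb that in auto)
    have "local_dual_section A U \<Phi> (\<lambda>p. flat A B p (N p (tinv p e)))"
      by (intro local_dual_section_flat[OF B] local_section_endo[OF N] local_section_tinv)
    then have "msmooth_on A U (\<lambda>p. flat A B p (N p (tinv p e)) (tinv p e'))"
      by (simp add: local_dual_section_def)
    then show ?thesis
      by (rule msmooth_on_cong[OF M open_U]) (simp add: flat_def twist_def tinv_fibre)
  qed
  ultimately show ?thesis
    unfolding Sym2_dual_def by blast
qed

end

section \<open>The Koszul-Vinberg bracket and the Nijenhuis torsion\<close>

text \<open>Kept in the shape of the equation in \<open>nijenhuis\<close>; the form E(Nx,y) - N
  E(x,y) is matched with it at the end of the bracket computation.\<close>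

definition torsion ::
  "('m, 'e, 'v::real_vector, 'f, 'z) ls_algebroid_scheme \<Rightarrow> ('m \<Rightarrow> 'v \<Rightarrow> 'v) \<Rightarrow>
    ('m \<Rightarrow> 'v) \<Rightarrow> ('m \<Rightarrow> 'v) \<Rightarrow> 'm \<Rightarrow> 'v" where
  "torsion A N x y = (\<lambda>p. prd A (app N x) (app N y) p -
     app N (\<lambda>p. prd A x (app N y) p + prd A (app N x) y p - app N (prd A x y) p) p)"

context
  fixes A :: "('m::{t2_space,second_countable_topology}, 'e::real_inner, 'v::real_vector,
      'f::real_inner, 'z) ls_algebroid_scheme"
  assumes lsa: "left_symmetric_algebroid A"
begin

lemma algebroid_vector_bundle: "vector_bundle A"
  using lsa by (simp add: left_symmetric_algebroid_def)

lemma prd_section: "x \<in> sections A \<Longrightarrow> y \<in> sections A \<Longrightarrow> prd A x y \<in> sections A"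
  using lsa by (simp add: left_symmetric_algebroid_def)

text \<open>In the converse direction \<open>sharp_flat A H B\<close> and \<open>N\<close> are known
  to agree on fibres only, so the two twisted forms cannot be identified as functions.\<close>

lemma delta_closed_cong:
  assumes "delta_closed A B" "\<And>p u v. u \<in> fibre A p \<Longrightarrow> v \<in> fibre A p \<Longrightarrow> B p u v = B' p u v"
  shows "delta_closed A B'"
  unfolding delta_closed_def
proof (intro ballI)
  fix x y z assume xyz: "x \<in> sections A" "y \<in> sections A" "z \<in> sections A"
  have *: "eval2 B' s t = eval2 B s t" if "\<And>p. s p \<in> fibre A p" "\<And>p. t p \<in> fibre A p" for s t
    using assms(2)[OF that] by (simp add: eval2_def)
  have "bracket A x y p \<in> fibre A p" for p
    unfolding bracket_def
    using section_fibre[OF algebroid_vector_bundle prd_section] xyz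
    by (intro subspace_diff[OF subspace_fibre[OF algebroid_vector_bundle]]) auto
  then have "coboundary A B' x y z = coboundary A B x y z"
    unfolding coboundary_def
    using xyz section_fibre[OF algebroid_vector_bundle] prd_section by (simp add: *)
  then show "coboundary A B' x y z = (\<lambda>p. 0)"
    using assms(1) xyz by (simp add: delta_closed_def)
qed

context
  fixes B N
  assumes B: "B \<in> Sym2_dual A" "delta_closed A B" and N: "bundle_endo A N"
    and sym: "\<And>p u v. u \<in> fibre A p \<Longrightarrow> v \<in> fibre A p \<Longrightarrow> B p (N p u) v = B p u (N p v)"
    and BN: "delta_closed A (twist B N)"
begin

lemma N_section: "x \<in> sections A \<Longrightarrow> app N x \<in> sections A"
  by (rule endo_in_sections[OF algebroid_vector_bundle N])

lemma N_fibre: "u \<in> fibre A p \<Longrightarrow> N p u \<in> fibre A p"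
  using N by (auto simp: bundle_endo_def)

lemma fibre_diff: "u \<in> fibre A p \<Longrightarrow> v \<in> fibre A p \<Longrightarrow> u - v \<in> fibre A p"
  and fibre_add: "u \<in> fibre A p \<Longrightarrow> v \<in> fibre A p \<Longrightarrow> u + v \<in> fibre A p"
  using subspace_fibre[OF algebroid_vector_bundle] subspace_diff subspace_add by blast+

lemma linear_on_diff:
  assumes "linear_on (fibre A p) h" "u \<in> fibre A p" "v \<in> fibre A p"
  shows "h (u - v) = h u - h v"
  using linear_on_sum[OF assms(1) subspace_fibre[OF algebroid_vector_bundle],
      of "{0,1::nat}" "\<lambda>i. if i = 0 then u else v" "\<lambda>i. if i = 0 then 1 else -1"] assms(2,3)
  by simp

lemmas B_diff = linear_on_diff[OF Sym2_dual_linear(2)[OF algebroid_vector_bundle B(1)]]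

lemmas in_fibre = section_fibre[OF algebroid_vector_bundle]

text \<open>Subtract \<open>\<delta>\<^sub>A B\<^sub>N (x, y, z) = 0\<close> from \<open>\<delta>\<^sub>A B (x, y, N z) = 0\<close>.\<close>

lemma endo_defect_symmetric:
  assumes x: "x \<in> sections A" and y: "y \<in> sections A" and z: "z \<in> sections A"
  shows "B p (y p) (prd A x (app N z) p - N p (prd A x z p)) =
    B p (x p) (prd A y (app N z) p - N p (prd A y z p))"
proof -
  note nz = N_section[OF z]
  \<comment> \<open>An equality of functions, not of values at \<open>p\<close>, because
    \<open>lie\<close> differentiates it. It makes the anchor and bracket terms of the two
    coboundaries literally equal.\<close>
  have tw: "eval2 (twist B N) s t = eval2 B s (app N t)"
    if "\<And>p. s p \<in> fibre A p" "\<And>p. t p \<in> fibre A p" for s t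
    using sym[OF that] by (simp add: eval2_def twist_def app_def)
  have br: "bracket A x y p \<in> fibre A p" for p
    unfolding bracket_def by (intro fibre_diff in_fibre prd_section x y)
  have "coboundary A B x y (app N z) p = 0" "coboundary A (twist B N) x y z p = 0"
    using B(2) BN x y z nz by (simp_all add: delta_closed_def)
  then have "eval2 B y (prd A x (app N z)) p - eval2 B y (app N (prd A x z)) p =
      eval2 B x (prd A y (app N z)) p - eval2 B x (app N (prd A y z)) p"
    unfolding coboundary_def
    by (simp add: tw in_fibre prd_section x y z br)
  then show ?thesis
    using B_diff in_fibre prd_section x y z nz N_fibre by (simp add: eval2_def app_def)
qed

lemma torsion_fibre:
  "x \<in> sections A \<Longrightarrow> y \<in> sections A \<Longrightarrow> torsion A N x y p \<in> fibre A p"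
  unfolding torsion_def app_def[of N "\<lambda>p. _ p - _ p"] app_def[of N "prd A x y"]
  by (intro fibre_diff fibre_add N_fibre in_fibre prd_section N_section)

text \<open>The tensor enters through its sharp map on covectors of the form
  \<open>flat A B p u\<close>. So one computation serves both directions, with \<open>H\<close>
  given in one and built from \<open>N\<close> in the other.\<close>

lemma kv_bracket_eq_torsion:
  assumes H: "\<And>p u. u \<in> fibre A p \<Longrightarrow> sharp A H p (flat A B p u) = N p u"
    and x: "x1 \<in> sections A" "x2 \<in> sections A" "x3 \<in> sections A"
  shows "kv_bracket A H (\<lambda>p. flat A B p (x1 p)) (\<lambda>p. flat A B p (x2 p)) (\<lambda>p. flat A B p (x3 p)) p =
    - B p (x2 p) (torsion A N x1 x3 p)"
proof -
  have sh: "app (sharp A H) (\<lambda>p. flat A B p (x p)) = app N x" if "x \<in> sections A" for x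
    using H in_fibre[OF that] by (simp add: app_def)
  have pr: "pair (\<lambda>p. flat A B p (x p)) y = eval2 B x y" if "\<And>p. y p \<in> fibre A p" for x y
    using that by (simp add: pair_def eval2_def flat_def)
  have es: "eval2 B s t = eval2 B t s" if "s \<in> sections A" "t \<in> sections A" for s t
    using Sym2_dual_sym[OF algebroid_vector_bundle B(1)] in_fibre that by (simp add: eval2_def)
  note n = N_section[OF x(1)] N_section[OF x(2)] N_section[OF x(3)]
  have br: "bracket A (app N x1) (app N x2) p \<in> fibre A p" for p
    unfolding bracket_def by (intro fibre_diff in_fibre prd_section n)
  txt \<open>The cocycle identity at \<open>(N x1, N x2, x3)\<close> eliminates the anchor terms of the bracket.\<close>
  have "coboundary A B (app N x1) (app N x2) x3 p = 0"
    using B(2) n x by (simp add: delta_closed_def)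
  then have cob: "lie A (app N x1) (eval2 B x3 (app N x2)) p - lie A (app N x2) (eval2 B x3 (app N x1)) p =
      eval2 B (app N x2) (prd A (app N x1) x3) p - eval2 B (app N x1) (prd A (app N x2) x3) p +
      eval2 B (bracket A (app N x1) (app N x2)) x3 p"
    by (simp add: coboundary_def es[OF n(1) x(3)] es[OF n(2) x(3)])
  have brs: "eval2 B (bracket A (app N x1) (app N x2)) x3 p = eval2 B x3 (bracket A (app N x1) (app N x2)) p"
    using Sym2_dual_sym[OF algebroid_vector_bundle B(1) br in_fibre[OF x(3)]] by (simp add: eval2_def)
  have Ns: "B p (app N x p) (y p) = B p (x p) (N p (y p))" if "x \<in> sections A" "y \<in> sections A" for x y
    using sym in_fibre that by (simp add: app_def)
  define D where "D x z = prd A x (app N z) p - N p (prd A x z p)" for x z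
  have Df: "D x z \<in> fibre A p" if "x \<in> sections A" "z \<in> sections A" for x z
    unfolding D_def by (intro fibre_diff in_fibre prd_section N_section N_fibre that)
  \<comment> \<open>The bracket term supplied by the cocycle identity cancels the last term of the
    Koszul-Vinberg bracket.\<close>
  have "kv_bracket A H (\<lambda>p. flat A B p (x1 p)) (\<lambda>p. flat A B p (x2 p)) (\<lambda>p. flat A B p (x3 p)) p =
      eval2 B (app N x2) (prd A (app N x1) x3) p - eval2 B (app N x1) (prd A (app N x2) x3) p +
      eval2 B x1 (prd A (app N x2) (app N x3)) p - eval2 B x2 (prd A (app N x1) (app N x3)) p"
    unfolding kv_bracket_def Let_def sh[OF x(1)] sh[OF x(2)] sh[OF x(3)]
    using cob brs by (simp add: pr in_fibre n prd_section br)
  \<comment> \<open>Symmetry moves \<open>N\<close> off \<open>x1\<close> and \<open>x2\<close> onto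
    the products; the four terms then pair up into two defects.\<close>
  also have "\<dots> = B p (x1 p) (D (app N x2) x3) - B p (x2 p) (D (app N x1) x3)"
    using B_diff in_fibre prd_section x n N_fibre
    by (simp add: Ns D_def eval2_def)
  \<comment> \<open>The defect symmetry for \<open>app N x2\<close> and \<open>x1\<close> frees the
    slot of \<open>x1\<close>; then \<open>N\<close> moves from \<open>x2\<close> onto the
    defect.\<close>
  also have "B p (x1 p) (D (app N x2) x3) = B p (x2 p) (N p (D x1 x3))"
    using endo_defect_symmetric[OF n(2) x(1) x(3), of p] sym[OF in_fibre[OF x(2)] Df[OF x(1,3)]]
    by (simp add: D_def app_def)
  also have "B p (x2 p) (N p (D x1 x3)) - B p (x2 p) (D (app N x1) x3) =
      - B p (x2 p) (D (app N x1) x3 - N p (D x1 x3))"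
    using B_diff[OF in_fibre[OF x(2)] Df[OF n(1) x(3)] N_fibre[OF Df[OF x(1,3)]]] by simp
  also have "D (app N x1) x3 - N p (D x1 x3) = torsion A N x1 x3 p"
  proof -
    have lin: "linear_on (fibre A p) (N p)"
      using N by (simp add: bundle_endo_def)
    have f: "prd A x1 (app N x3) p \<in> fibre A p" "prd A (app N x1) x3 p \<in> fibre A p"
      "N p (prd A x1 x3 p) \<in> fibre A p"
      by (intro in_fibre prd_section N_fibre x n)+
    have "N p (prd A x1 (app N x3) p + prd A (app N x1) x3 p - N p (prd A x1 x3 p)) =
        N p (prd A x1 (app N x3) p) + N p (prd A (app N x1) x3 p) - N p (N p (prd A x1 x3 p))"
      using linear_on_diff[OF lin fibre_add[OF f(1,2)] f(3)] lin f by (simp add: linear_on_def)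
    then show ?thesis
      using linear_on_diff[OF lin f(1,3)] by (simp add: torsion_def D_def app_def)
  qed
  finally show ?thesis .
qed

end

section \<open>The two implications\<close>

lemma nijenhuis_iff_torsion:
  "nijenhuis A N \<longleftrightarrow>
    bundle_endo A N \<and> (\<forall>x\<in>sections A. \<forall>y\<in>sections A. \<forall>p. torsion A N x y p = 0)"
  by (simp add: nijenhuis_def torsion_def fun_eq_iff)

lemma KVOmega_imp_pseudo_hessian_nijenhuis:
  assumes KV: "KVOmega A H B" and nd: "nondegenerate A B"
  shows "pseudo_hessian_nijenhuis A B (sharp_flat A H B)"
proof -
  let ?N = "sharp_flat A H B"
  note vb = algebroid_vector_bundle
  have H: "H \<in> Sym2 A" and B: "B \<in> Sym2_dual A" "delta_closed A B" and BN: "delta_closed A (twist B ?N)"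
    using KV by (auto simp: KVOmega_def koszul_vinberg_def pseudo_hessian_def)
  have N: "bundle_endo A ?N"
    by (rule bundle_endo_sharp_flat[OF vb H B(1)])
  note sym = sharp_flat_symmetric[OF vb H B(1)]
  have "torsion A ?N x z p = 0" if xz: "x \<in> sections A" "z \<in> sections A" for x z p
  proof (rule nondegenerate_eq_0[OF vb B(1) nd])
    show "torsion A ?N x z p \<in> fibre A p"
      by (rule torsion_fibre[OF B N sym BN xz])
    fix v assume "v \<in> fibre A p"
    then obtain y where y: "y \<in> sections A" "y p = v"
      using section_through[OF vb] by blast
    \<comment> \<open>The middle covector is the free one: \<open>x\<close> and \<open>z\<close>
      occupy the outer slots, while \<open>y\<close> takes an arbitrary value \<open>v\<close> at
      \<open>p\<close>.\<close>
    have "kv_bracket A H (\<lambda>p. flat A B p (x p)) (\<lambda>p. flat A B p (y p)) (\<lambda>p. flat A B p (z p)) p = 0"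
      using KV flat_in_dual_sections[OF vb B(1)] xz y by (simp add: KVOmega_def koszul_vinberg_def)
    then show "B p v (torsion A ?N x z p) = 0"
      using kv_bracket_eq_torsion[OF B N sym BN _ xz(1) y(1) xz(2), of H p] y(2)
      by (simp add: sharp_flat_def)
  qed
  then have "nijenhuis A ?N"
    using N by (simp add: nijenhuis_iff_torsion)
  moreover have "eval2 B (app ?N x) y = eval2 B x (app ?N y)"
    if "x \<in> sections A" "y \<in> sections A" for x y
    using sym section_fibre[OF vb] that by (simp add: eval2_def app_def)
  ultimately show ?thesis
    using B BN by (simp add: pseudo_hessian_nijenhuis_def pseudo_hessian_def)
qed

lemma pseudo_hessian_nijenhuis_imp_KVOmega:
  assumes PHN: "pseudo_hessian_nijenhuis A B N" and nd: "nondegenerate A B"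
  defines "H \<equiv> tensor_of_sharp (\<lambda>p \<alpha>. N p (flat_inv A B p \<alpha>))"
  shows "\<alpha> \<in> dual_fibre A p \<Longrightarrow> sharp A H p \<alpha> = N p (flat_inv A B p \<alpha>)" and "KVOmega A H B"
proof -
  note vb = algebroid_vector_bundle
  have B: "B \<in> Sym2_dual A" "delta_closed A B" and N: "bundle_endo A N"
    and BN: "delta_closed A (twist B N)"
    and torsion: "\<And>x y p. x \<in> sections A \<Longrightarrow> y \<in> sections A \<Longrightarrow> torsion A N x y p = 0"
    using PHN by (auto simp: pseudo_hessian_nijenhuis_def pseudo_hessian_def nijenhuis_iff_torsion)
  \<comment> \<open>The structure provides this identity on global sections only, while the tensor
    constructions need it vector by vector.\<close>
  have sym: "B p (N p u) v = B p u (N p v)" if uv: "u \<in> fibre A p" "v \<in> fibre A p" for p u v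
  proof -
    obtain x where x: "x \<in> sections A" "x p = u"
      using section_through[OF vb uv(1)] .
    obtain y where y: "y \<in> sections A" "y p = v"
      using section_through[OF vb uv(2)] .
    have "eval2 B (app N x) y = eval2 B x (app N y)"
      using PHN x y by (simp add: pseudo_hessian_nijenhuis_def)
    then have "eval2 B (app N x) y p = eval2 B x (app N y) p"
      by simp
    then show ?thesis
      using x y by (simp add: eval2_def app_def)
  qed
  have H: "H \<in> Sym2 A"
    unfolding H_def by (rule tensor_of_sharp_in_Sym2[OF vb B(1) nd N]) (rule sym)
  show "sharp A H p \<alpha> = N p (flat_inv A B p \<alpha>)" if "\<alpha> \<in> dual_fibre A p" for \<alpha> p
    unfolding H_def by (rule sharp_tensor_of_sharp[OF vb B(1) nd N _ that]) (rule sym)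
  have SN: "sharp_flat A H B p u = N p u" if "u \<in> fibre A p" for p u
    unfolding H_def by (rule sharp_flat_tensor_of_sharp[OF vb B(1) nd N _ that]) (rule sym)
  have "koszul_vinberg A H"
    unfolding koszul_vinberg_def
  proof (intro conjI ballI H ext)
    fix \<alpha>1 \<alpha>2 \<alpha>3 p
    assume "\<alpha>1 \<in> dual_sections A" "\<alpha>2 \<in> dual_sections A" "\<alpha>3 \<in> dual_sections A"
    note a = this
    \<comment> \<open>Arbitrary covector fields become \<open>flat\<close> of smooth sections, so
      the bracket formula applies to them.\<close>
    note x = a[THEN flat_inv_in_sections[OF vb B(1) nd]]
    have e: "(\<lambda>p. flat A B p (flat_inv A B p (\<alpha> p))) = \<alpha>" if "\<alpha> \<in> dual_sections A" for \<alpha>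
      using flat_inv_fibre(2)[OF vb nd] that by (simp add: dual_sections_def)
    have "kv_bracket A H \<alpha>1 \<alpha>2 \<alpha>3 p = - B p (flat_inv A B p (\<alpha>2 p)) 0"
      using kv_bracket_eq_torsion[OF B N sym BN _ x, of H p] SN torsion[OF x(1,3), of p]
      by (simp add: e a sharp_flat_def)
    also have "\<dots> = 0"
      using linear_on_sum[OF Sym2_dual_linear(2)[OF vb B(1) section_fibre[OF vb x(2)]]
          subspace_fibre[OF vb], of "{}"] by simp
    finally show "kv_bracket A H \<alpha>1 \<alpha>2 \<alpha>3 p = 0" .
  qed
  moreover have "twist B (sharp_flat A H B) \<in> Sym2_dual A"
    by (rule twist_in_Sym2_dual[OF vb B(1) bundle_endo_sharp_flat[OF vb H B(1)]])
      (rule sharp_flat_symmetric[OF vb H B(1)])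
  moreover have "delta_closed A (twist B (sharp_flat A H B))"
    by (rule delta_closed_cong[OF BN]) (simp add: twist_def SN)
  ultimately show "KVOmega A H B"
    using B by (simp add: KVOmega_def pseudo_hessian_def)
qed

end

theorem theorem6p5:
  fixes A :: "('m::{t2_space,second_countable_topology}, 'e::real_inner,
               'v::real_vector, 'f::real_inner) ls_algebroid"
  assumes "left_symmetric_algebroid A"
  shows
    "(\<forall>H B. KVOmega A H B \<and> nondegenerate A B \<longrightarrow>
        pseudo_hessian_nijenhuis A B (sharp_flat A H B)) \<and>
     (\<forall>B N. pseudo_hessian_nijenhuis A B N \<and> nondegenerate A B \<longrightarrow>
        (let \<H> = tensor_of_sharp (\<lambda>p \<alpha>. N p (flat_inv A B p \<alpha>)) in
           (\<forall>p. \<forall>\<alpha>\<in>dual_fibre A p. sharp A \<H> p \<alpha> = N p (flat_inv A B p \<alpha>)) \<and>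
           KVOmega A \<H> B))"
proof (intro conjI allI impI)
  fix H B assume "KVOmega A H B \<and> nondegenerate A B"
  then show "pseudo_hessian_nijenhuis A B (sharp_flat A H B)"
    using KVOmega_imp_pseudo_hessian_nijenhuis[OF assms] by blast
next
  fix B N assume "pseudo_hessian_nijenhuis A B N \<and> nondegenerate A B"
  then show "let \<H> = tensor_of_sharp (\<lambda>p \<alpha>. N p (flat_inv A B p \<alpha>)) in
      (\<forall>p. \<forall>\<alpha>\<in>dual_fibre A p. sharp A \<H> p \<alpha> = N p (flat_inv A B p \<alpha>)) \<and> KVOmega A \<H> B"
    using pseudo_hessian_nijenhuis_imp_KVOmega[OF assms] by (simp add: Let_def)
qed

end
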